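(* Let $\Bbbk$ be an arbitrary field, $Q$ a finite quiver, and $\alpha,\zeta$ two dimension vectors for $Q$. (1) Each stable pair $(M,f)\in\mathrm{Rep}^s(Q,\alpha,\zeta)$ possesses a finite family of normal forms, one for each $J$-skeleton of $(M,f)$: if $\mathfrak{S}$ is a $J$-skeleton of $(M,f)$, the corresponding normal form of $(M,f)$ is $(M^C,f^C)$, where $C=\pi_{\mathfrak{S}}(M,f)$. (That is, $(M,f)$ has finitely many $J$-skeleta, and for each of them $(M^C,f^C)$ is a stable pair isomorphic to $(M,f)$ which depends only on $\mathfrak{S}$ and on the isomorphism class of $(M,f)$.) (2) The following procedure correctly determines whether two stable pairs $(M,f),(M',f')\in\mathrm{Rep}^s(Q,\alpha,\zeta)$ are isomorphic: (a) compute the tuples of matrices $B=\widehat\Phi_{(M,f)}$ and $B'=\widehat\Phi_{(M',f')}$; (b) find the $J$-skeleta of the two pairs by seeking non-degenerate maximal minors of $B$ and $B'$ (a $J$-skeleton $\mathfrak S$ with dimension vector $\alpha$ is a $J$-skeleton of $(M,f)$ when all $\det B(\mathfrak{S}_i)$, $i\in Q_0$, are nonzero, and similarly for $(M',f')$); (c) if the pairs have no common $J$-skeleton, they are not isomorphic; (d) if $\mathfrak{S}$ is a common $J$-skeleton, compute $(M^C,f^C)$ and $(M^{C'},f^{C'})$ for $C=\pi_{\mathfrak{S}}(M,f)$ and $C'=\pi_{\mathfrak{S}}(M',f')$; (e) the pairs $(M,f)$ and $(M',f')$ are isomorphic if and only if $(M^C,f^C)=(M^{C'},f^{C'})$.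
   Context: Quivers and framed representations. $Q$ is a finite quiver with vertex set $Q_0$, arrow set $Q_1$, and head and tail maps $h,t:Q_1\to Q_0$; dimension vectors have non-negative integer entries. $\mathrm{Rep}(Q,\alpha)=\bigoplus_{a\in Q_1}\mathrm{Hom}(\Bbbk^{\alpha_{ta}},\Bbbk^{\alpha_{ha}})$ and $GL(\alpha)=\prod_{i\in Q_0}GL_{\alpha_i}(\Bbbk)$. The space of framed representations is $\mathrm{Rep}(Q,\alpha,\zeta)=\mathrm{Rep}(Q,\alpha)\oplus\bigoplus_{i\in Q_0}\mathrm{Hom}(\Bbbk^{\alpha_i},\Bbbk^{\zeta_i})$; its elements are pairs $(M,f)$, $f=(f_i)_{i\in Q_0}$, and $GL(\alpha)$ acts by $g\cdot(M,f)=\big((g_{ha}M_ag_{ta}^{-1})_{a\in Q_1},(f_ig_i^{-1})_{i\in Q_0}\big)$. Two pairs are isomorphic if they lie in the same $GL(\alpha)$-orbit. A pair $(M,f)$ is stable if there is no nonzero subrepresentation $N$ of $M$ with $N_i\subseteq\ker f_i$ for all $i\in Q_0$. $\mathrm{Rep}^s(Q,\alpha,\zeta)$ is the set of stable pairs. Paths. A path is a product of arrows $a_1\cdots a_k$ with $t(a_i)=h(a_{i+1})$ (so $a_k$ is applied first), with tail $t(a_k)$ and head $h(a_1)$, or a path $e_i$ of length zero at a vertex $i$. Extended quiver. $Q^\zeta$ has vertices $Q_0\cup\{\infty\}$; its arrows are those of $Q$ together with arrows $f_{iq}:i\to\infty$ for $i\in Q_0$, $q=1,\dots,\zeta_i$.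 A pair $(M,f)$ is identified with a representation $\widetilde M$ of $Q^\zeta$ with $\widetilde M_i=\Bbbk^{\alpha_i}$ for $i\in Q_0$, $\widetilde M_\infty=\Bbbk$, $\widetilde M_a=M_a$ for $a\in Q_1$, and $\widetilde M_{f_{iq}}$ the $q$-th row of the matrix of $f_i$. For a path $\pi=b_1\cdots b_k$ in $Q^\zeta$ put $\widetilde M_\pi=\widetilde M_{b_1}\cdots\widetilde M_{b_k}$. The representation $\widetilde J$. For a vertex $i$ of $Q^\zeta$, $\widetilde J_i$ is the dual of the vector space with basis the set of paths from $i$ to $\infty$ (so $\widetilde J_\infty=\Bbbk$), and $\widetilde J=\bigoplus_i\widetilde J_i$. Each path $\pi$ from $i$ to $\infty$ is viewed as a linear function on $\widetilde J$: $\xi\mapsto\xi(\pi)$ on $\widetilde J_i$ and zero on the other components. The map $\widetilde\Phi_{\widetilde M}:\widetilde M\to\widetilde J$ sends $x\in\widetilde M_i$ to the element of $\widetilde J_i$ given by $\pi\mapsto\widetilde M_\pi(x)$. $J$-skeleta. A $J$-skeleton of a stable pair $(M,f)$ is a set $\mathfrak{S}$ of paths of nonzero length in $Q^\zeta$ ending in $\infty$ such that: (i) the restrictions of the paths in $\mathfrak{S}$, together with that of $e_\infty$, form a basis of $\big(\widetilde\Phi_{\widetilde M}(\widetilde M)\big)^*$; (ii) whenever $\tau a\in\mathfrak{S}$ with $a$ an arrow and $\tau\ne e_\infty$, also $\tau\in\mathfrak{S}$. A "$J$-skeleton with dimension vector $\alpha$" is a $J$-skeleton of some stable pair in $\mathrm{Rep}^s(Q,\alpha,\zeta)$.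 $\mathfrak{S}_i$ is the set of paths in $\mathfrak{S}$ starting at $i\in Q_0$; it has $\alpha_i$ elements. Each $\mathfrak{S}_i$ is given a fixed order. The matrices $B$. $\Gamma(\alpha)$ is the set of all paths occurring in $J$-skeleta with dimension vector $\alpha$; $\widetilde\Gamma(\alpha)=\Gamma(\alpha)\cup\{\tau a\mid\tau\in\Gamma(\alpha),\,a\in Q_1,\,h(a)=t(\tau)\}$; $\widetilde\Gamma_i(\alpha)$ is the subset of paths starting at $i$. $B=\widehat\Phi_{(M,f)}=(B^{(i)})_{i\in Q_0}$, where $B^{(i)}$ is the $|\widetilde\Gamma_i(\alpha)|\times\alpha_i$ matrix whose row corresponding to $\pi\in\widetilde\Gamma_i(\alpha)$ is $B_\pi=\widetilde M_\pi$. $B(\mathfrak{S}_i)$ is the square submatrix of $B^{(i)}$ formed by the rows indexed by $\mathfrak{S}_i$. The map $\pi_{\mathfrak{S}}$ and the normal form. Let $\widehat{\mathfrak{S}}_i$ be the set of paths starting at $i$ consisting of all $\tau a\notin\mathfrak{S}$ with $a\in Q_1$, $t(a)=i$, $\tau\in\mathfrak{S}_{h(a)}$, and all $f_{iq}\notin\mathfrak{S}$. For a stable pair $(M,f)$ with $J$-skeleton $\mathfrak{S}$, $\pi_{\mathfrak{S}}(M,f)=C=(C^{(i)})_{i\in Q_0}$, where $C^{(i)}$ is the matrix formed by the rows of $B^{(i)}B(\mathfrak{S}_i)^{-1}$ indexed by $\widehat{\mathfrak{S}}_i$; write $C_\pi$ for its row indexed by $\pi$. Let $E^{(i)}$ be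 the $\alpha_i\times\alpha_i$ identity matrix with rows indexed by $\mathfrak{S}_i$ (in the chosen order), and $E_\pi$ its row indexed by $\pi\in\mathfrak{S}_i$. Given $C$, the pair $(M^C,f^C)$ is defined as follows: for $a\in Q_1$, the row of the $\alpha_{ha}\times\alpha_{ta}$ matrix $M^C_a$ in the position of $\tau\in\mathfrak{S}_{ha}$ is $E_{\tau a}$ if $\tau a\in\mathfrak{S}$ and $C_{\tau a}$ otherwise; the $q$-th row of $f^C_i$ is $E_{f_{iq}}$ if $f_{iq}\in\mathfrak{S}$ and $C_{f_{iq}}$ otherwise. *)

theory Defs
  imports
    "Graph_Theory.Arc_Walk"
    "Jordan_Normal_Form.Determinant"
    "Jordan_Normal_Form.Gauss_Jordan_Elimination"
    "Jordan_Normal_Form.Matrix_Kernel"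
    "Jordan_Normal_Form.VS_Connect"
    "HOL-Library.Poly_Mapping"
    "HOL-Library.FuncSet"
begin

section \<open>Vector spaces\<close>

definition field_vs :: "('k :: field, 'k) module" where
  "field_vs = \<lparr>carrier = UNIV, mult = (*), one = 1, zero = 0, add = (+), smult = (*)\<rparr>"

text \<open>The vector space with basis \<open>X\<close>; the basis vector of \<open>x\<close> is \<open>Poly_Mapping.single x 1\<close>.\<close>

definition free_vs :: "'x set \<Rightarrow> ('k :: field, 'x \<Rightarrow>\<^sub>0 'k) module" where
  "free_vs X = \<lparr>carrier = {p. Poly_Mapping.keys p \<subseteq> X}, mult = undefined, one = undefined,
     zero = 0, add = (+), smult = (\<lambda>c. Poly_Mapping.map (\<lambda>x. c * x))\<rparr>"

text \<open>Functionals are extensional functions, so that they are determined by their values on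
  the space.\<close>

definition dual_vs :: "('k :: field, 'x, 'm) module_scheme \<Rightarrow> ('k, 'x \<Rightarrow> 'k) module" where
  "dual_vs V = (ring.func_space class_ring (carrier V))
     \<lparr>carrier := module_hom class_ring V field_vs \<inter> extensional (carrier V)\<rparr>"

text \<open>The product of a family of vector spaces; only used for finite families, where it is the
  direct sum.\<close>

definition product_vs ::
  "'i set \<Rightarrow> ('i \<Rightarrow> ('k :: field, 'x) module) \<Rightarrow> ('k, 'i \<Rightarrow> 'x) module" where
  "product_vs I V = \<lparr>carrier = (\<Pi>\<^sub>E i\<in>I. carrier (V i)), mult = undefined, one = undefined,
     zero = (\<lambda>i\<in>I. \<zero>\<^bsub>V i\<^esub>), add = (\<lambda>x y. \<lambda>i\<in>I. x i \<oplus>\<^bsub>V i\<^esub> y i),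
     smult = (\<lambda>c x. \<lambda>i\<in>I. c \<odot>\<^bsub>V i\<^esub> x i)\<rparr>"

text \<open>The inverse matrix; unspecified if \<open>A\<close> is not invertible.\<close>

definition mat_inv :: "'k :: field mat \<Rightarrow> 'k mat" where
  "mat_inv A = the (mat_inverse A)"

section \<open>Framed representations\<close>

text \<open>A finite quiver is a \<open>fin_digraph\<close>, where loops and multiple arrows are allowed.
  A pair \<open>(M, f)\<close> consists of extensional families indexed by the arrows and by the vertices,
  so equality of pairs is equality of all their matrices.\<close>

type_synonym ('v, 'a, 'k) framed = "('a \<Rightarrow> 'k mat) \<times> ('v \<Rightarrow> 'k mat)"

definition framed_reps ::
  "('v, 'a) pre_digraph \<Rightarrow> ('v \<Rightarrow> nat) \<Rightarrow> ('v \<Rightarrow> nat) \<Rightarrow> ('v, 'a, 'k :: field) framed set" where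
  "framed_reps Q \<alpha> \<zeta> =
     (\<Pi>\<^sub>E a\<in>arcs Q. carrier_mat (\<alpha> (head Q a)) (\<alpha> (tail Q a))) \<times>
     (\<Pi>\<^sub>E i\<in>verts Q. carrier_mat (\<zeta> i) (\<alpha> i))"

definition GL :: "('v, 'a) pre_digraph \<Rightarrow> ('v \<Rightarrow> nat) \<Rightarrow> ('v \<Rightarrow> 'k :: field mat) set" where
  "GL Q \<alpha> = (\<Pi>\<^sub>E i\<in>verts Q. {g \<in> carrier_mat (\<alpha> i) (\<alpha> i). invertible_mat g})"

definition GL_act ::
  "('v, 'a) pre_digraph \<Rightarrow> ('v \<Rightarrow> 'k :: field mat) \<Rightarrow> ('v, 'a, 'k) framed \<Rightarrow> ('v, 'a, 'k) framed"
where
  "GL_act Q g = (\<lambda>(M, f).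
     (\<lambda>a\<in>arcs Q. g (head Q a) * M a * mat_inv (g (tail Q a)),
      \<lambda>i\<in>verts Q. f i * mat_inv (g i)))"

definition isomorphic ::
  "('v, 'a) pre_digraph \<Rightarrow> ('v \<Rightarrow> nat) \<Rightarrow>
   ('v, 'a, 'k :: field) framed \<Rightarrow> ('v, 'a, 'k) framed \<Rightarrow> bool" where
  "isomorphic Q \<alpha> Mf Mf' \<longleftrightarrow> (\<exists>g\<in>GL Q \<alpha>. Mf' = GL_act Q g Mf)"

definition subrep ::
  "('v, 'a) pre_digraph \<Rightarrow> ('v \<Rightarrow> nat) \<Rightarrow> ('a \<Rightarrow> 'k :: field mat) \<Rightarrow> ('v \<Rightarrow> 'k vec set) \<Rightarrow> bool"
where
  "subrep Q \<alpha> M N \<longleftrightarrow>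
     (\<forall>i\<in>verts Q. VectorSpace.subspace class_ring (N i) (module_vec TYPE('k) (\<alpha> i))) \<and>
     (\<forall>a\<in>arcs Q. \<forall>x\<in>N (tail Q a). M a *\<^sub>v x \<in> N (head Q a))"

definition stable ::
  "('v, 'a) pre_digraph \<Rightarrow> ('v \<Rightarrow> nat) \<Rightarrow> ('v, 'a, 'k :: field) framed \<Rightarrow> bool" where
  "stable Q \<alpha> = (\<lambda>(M, f).
     \<not> (\<exists>N. subrep Q \<alpha> M N \<and> (\<exists>i\<in>verts Q. N i \<noteq> {0\<^sub>v (\<alpha> i)}) \<and>
           (\<forall>i\<in>verts Q. N i \<subseteq> mat_kernel (f i))))"

definition stable_reps ::
  "('v, 'a) pre_digraph \<Rightarrow> ('v \<Rightarrow> nat) \<Rightarrow> ('v \<Rightarrow> nat) \<Rightarrow> ('v, 'a, 'k :: field) framed set" where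
  "stable_reps Q \<alpha> \<zeta> = {Mf \<in> framed_reps Q \<alpha> \<zeta>. stable Q \<alpha> Mf}"

section \<open>The extended quiver and its paths\<close>

datatype 'v ext_vertex = Vertex 'v | Infinity

datatype ('v, 'a) ext_arc = Arrow 'a | Frame 'v nat

text \<open>The arrows \<open>f\<^bsub>iq\<^esub>\<close>, like the rows of a matrix, are numbered from \<open>0\<close>.\<close>

definition ext_quiver ::
  "('v, 'a) pre_digraph \<Rightarrow> ('v \<Rightarrow> nat) \<Rightarrow> ('v ext_vertex, ('v, 'a) ext_arc) pre_digraph" where
  "ext_quiver Q \<zeta> = \<lparr>
     verts = insert Infinity (Vertex ` verts Q),
     arcs = Arrow ` arcs Q \<union> {Frame i q | i q. i \<in> verts Q \<and> q < \<zeta> i},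
     tail = (\<lambda>b. case b of Arrow a \<Rightarrow> Vertex (tail Q a) | Frame i q \<Rightarrow> Vertex i),
     head = (\<lambda>b. case b of Arrow a \<Rightarrow> Vertex (head Q a) | Frame i q \<Rightarrow> Infinity)\<rparr>"

text \<open>A path is its tail together with the list of its arrows in the order of application,
  i.e. the list reverses the product notation: if \<open>\<tau> = (t, p)\<close>, then the product \<open>\<tau> a\<close>
  is \<open>(tail a, a # p)\<close>, and \<open>e\<^sub>i\<close> is \<open>(i, [])\<close>.\<close>

type_synonym ('v, 'a) qpath = "'v ext_vertex \<times> ('v, 'a) ext_arc list"

definition paths_to_inf ::
  "('v, 'a) pre_digraph \<Rightarrow> ('v \<Rightarrow> nat) \<Rightarrow> 'v ext_vertex \<Rightarrow> ('v, 'a) qpath set" where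
  "paths_to_inf Q \<zeta> i = {(i, p) | p. pre_digraph.awalk (ext_quiver Q \<zeta>) i p Infinity}"

primrec ext_dim :: "('v \<Rightarrow> nat) \<Rightarrow> 'v ext_vertex \<Rightarrow> nat" where
  "ext_dim \<alpha> (Vertex i) = \<alpha> i"
| "ext_dim \<alpha> Infinity = 1"

primrec ext_rep ::
  "('v \<Rightarrow> nat) \<Rightarrow> ('v, 'a, 'k :: field) framed \<Rightarrow> ('v, 'a) ext_arc \<Rightarrow> 'k mat" where
  "ext_rep \<alpha> Mf (Arrow a) = fst Mf a"
| "ext_rep \<alpha> Mf (Frame i q) = mat_of_rows (\<alpha> i) [row (snd Mf i) q]"

primrec walk_mat ::
  "('v, 'a) pre_digraph \<Rightarrow> ('v \<Rightarrow> nat) \<Rightarrow> ('v \<Rightarrow> nat) \<Rightarrow> ('v, 'a, 'k :: field) framed \<Rightarrow>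
   ('v, 'a) ext_arc list \<Rightarrow> 'v ext_vertex \<Rightarrow> 'k mat" where
  "walk_mat Q \<alpha> \<zeta> Mf [] i = 1\<^sub>m (ext_dim \<alpha> i)"
| "walk_mat Q \<alpha> \<zeta> Mf (b # p) i =
     walk_mat Q \<alpha> \<zeta> Mf p (head (ext_quiver Q \<zeta>) b) * ext_rep \<alpha> Mf b"

definition path_mat ::
  "('v, 'a) pre_digraph \<Rightarrow> ('v \<Rightarrow> nat) \<Rightarrow> ('v \<Rightarrow> nat) \<Rightarrow> ('v, 'a, 'k :: field) framed \<Rightarrow>
   ('v, 'a) qpath \<Rightarrow> 'k mat" where
  "path_mat Q \<alpha> \<zeta> Mf \<pi> = walk_mat Q \<alpha> \<zeta> Mf (snd \<pi>) (fst \<pi>)"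

section \<open>The map to the dual path space\<close>

definition J_space ::
  "'k :: field itself \<Rightarrow> ('v, 'a) pre_digraph \<Rightarrow> ('v \<Rightarrow> nat) \<Rightarrow>
   ('k, 'v ext_vertex \<Rightarrow> (('v, 'a) qpath \<Rightarrow>\<^sub>0 'k) \<Rightarrow> 'k) module" where
  "J_space _ Q \<zeta> =
     product_vs (verts (ext_quiver Q \<zeta>)) (\<lambda>i. dual_vs (free_vs (paths_to_inf Q \<zeta> i)))"

definition path_fun ::
  "('v, 'a) qpath \<Rightarrow> ('v ext_vertex \<Rightarrow> (('v, 'a) qpath \<Rightarrow>\<^sub>0 'k :: field) \<Rightarrow> 'k) \<Rightarrow> 'k" where
  "path_fun \<pi> \<xi> = \<xi> (fst \<pi>) (Poly_Mapping.single \<pi> 1)"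

definition ext_space ::
  "'k :: field itself \<Rightarrow> ('v, 'a) pre_digraph \<Rightarrow> ('v \<Rightarrow> nat) \<Rightarrow> ('v \<Rightarrow> nat) \<Rightarrow>
   ('k, 'v ext_vertex \<Rightarrow> 'k vec) module" where
  "ext_space _ Q \<alpha> \<zeta> =
     product_vs (verts (ext_quiver Q \<zeta>)) (\<lambda>i. module_vec TYPE('k) (ext_dim \<alpha> i))"

text \<open>The functional \<open>\<pi> \<mapsto> M\<^sub>\<pi> x\<close>, given on basis vectors, is extended linearly to the free
  vector space; \<open>M\<^sub>\<pi> x\<close> is a vector with one coordinate, as \<open>\<pi>\<close> ends in \<open>Infinity\<close>.\<close>

definition Phi ::
  "('v, 'a) pre_digraph \<Rightarrow> ('v \<Rightarrow> nat) \<Rightarrow> ('v \<Rightarrow> nat) \<Rightarrow> ('v, 'a, 'k :: field) framed \<Rightarrow>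
   ('v ext_vertex \<Rightarrow> 'k vec) \<Rightarrow> 'v ext_vertex \<Rightarrow> (('v, 'a) qpath \<Rightarrow>\<^sub>0 'k) \<Rightarrow> 'k" where
  "Phi Q \<alpha> \<zeta> Mf x =
     (\<lambda>i\<in>verts (ext_quiver Q \<zeta>).
      \<lambda>p\<in>carrier (free_vs (paths_to_inf Q \<zeta> i) :: ('k, ('v, 'a) qpath \<Rightarrow>\<^sub>0 'k) module).
        \<Sum>\<pi>\<in>Poly_Mapping.keys p.
          Poly_Mapping.lookup p \<pi> * (path_mat Q \<alpha> \<zeta> Mf \<pi> *\<^sub>v x i) $ 0)"

definition Phi_image ::
  "('v, 'a) pre_digraph \<Rightarrow> ('v \<Rightarrow> nat) \<Rightarrow> ('v \<Rightarrow> nat) \<Rightarrow> ('v, 'a, 'k :: field) framed \<Rightarrow>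
   ('v ext_vertex \<Rightarrow> (('v, 'a) qpath \<Rightarrow>\<^sub>0 'k) \<Rightarrow> 'k) set" where
  "Phi_image Q \<alpha> \<zeta> Mf = Phi Q \<alpha> \<zeta> Mf ` carrier (ext_space TYPE('k) Q \<alpha> \<zeta>)"

section \<open>J-skeleta\<close>

definition inf_path :: "('v, 'a) qpath" where
  "inf_path = (Infinity, [])"

text \<open>The restricted functions form a basis as a family, hence the injectivity.\<close>

definition restrictions_basis ::
  "('v, 'a) pre_digraph \<Rightarrow> ('v \<Rightarrow> nat) \<Rightarrow> ('v \<Rightarrow> nat) \<Rightarrow> ('v, 'a, 'k :: field) framed \<Rightarrow>
   ('v, 'a) qpath set \<Rightarrow> bool" where
  "restrictions_basis Q \<alpha> \<zeta> Mf P \<longleftrightarrow>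
     (let W = Phi_image Q \<alpha> \<zeta> Mf; r = (\<lambda>\<pi>. restrict (path_fun \<pi>) W) in
       inj_on r P \<and>
       vectorspace.basis class_ring (dual_vs (J_space TYPE('k) Q \<zeta> \<lparr>carrier := W\<rparr>)) (r ` P))"

definition J_skeleta ::
  "('v, 'a) pre_digraph \<Rightarrow> ('v \<Rightarrow> nat) \<Rightarrow> ('v \<Rightarrow> nat) \<Rightarrow> ('v, 'a, 'k :: field) framed \<Rightarrow>
   ('v, 'a) qpath set set" where
  "J_skeleta Q \<alpha> \<zeta> Mf = {S.
     S \<subseteq> {\<pi> \<in> (\<Union>i. paths_to_inf Q \<zeta> i). snd \<pi> \<noteq> []} \<and>
     restrictions_basis Q \<alpha> \<zeta> Mf (insert inf_path S) \<and>
     (\<forall>i b p. (i, b # p) \<in> S \<and> p \<noteq> [] \<longrightarrow> (head (ext_quiver Q \<zeta>) b, p) \<in> S)}"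

definition J_skeleta_of_dim ::
  "'k :: field itself \<Rightarrow> ('v, 'a) pre_digraph \<Rightarrow> ('v \<Rightarrow> nat) \<Rightarrow> ('v \<Rightarrow> nat) \<Rightarrow>
   ('v, 'a) qpath set set" where
  "J_skeleta_of_dim _ Q \<alpha> \<zeta> =
     (\<Union>Mf \<in> (stable_reps Q \<alpha> \<zeta> :: ('v, 'a, 'k) framed set). J_skeleta Q \<alpha> \<zeta> Mf)"

definition paths_at :: "('v, 'a) qpath set \<Rightarrow> 'v \<Rightarrow> ('v, 'a) qpath set" where
  "paths_at S i = {\<pi> \<in> S. fst \<pi> = Vertex i}"

text \<open>An order on every \<open>\<SS>\<^sub>i\<close> is given by listing its elements.\<close>

type_synonym ('v, 'a) path_order = "('v, 'a) qpath set \<Rightarrow> 'v \<Rightarrow> ('v, 'a) qpath list"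

definition is_path_order ::
  "'k :: field itself \<Rightarrow> ('v, 'a) pre_digraph \<Rightarrow> ('v \<Rightarrow> nat) \<Rightarrow> ('v \<Rightarrow> nat) \<Rightarrow>
   ('v, 'a) path_order \<Rightarrow> bool" where
  "is_path_order K Q \<alpha> \<zeta> ord \<longleftrightarrow>
     (\<forall>S\<in>J_skeleta_of_dim K Q \<alpha> \<zeta>. \<forall>i\<in>verts Q.
        distinct (ord S i) \<and> set (ord S i) = paths_at S i)"

section \<open>The matrices B\<close>

definition Gamma ::
  "'k :: field itself \<Rightarrow> ('v, 'a) pre_digraph \<Rightarrow> ('v \<Rightarrow> nat) \<Rightarrow> ('v \<Rightarrow> nat) \<Rightarrow> ('v, 'a) qpath set"
where
  "Gamma K Q \<alpha> \<zeta> = \<Union> (J_skeleta_of_dim K Q \<alpha> \<zeta>)"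

definition Gamma_tilde ::
  "'k :: field itself \<Rightarrow> ('v, 'a) pre_digraph \<Rightarrow> ('v \<Rightarrow> nat) \<Rightarrow> ('v \<Rightarrow> nat) \<Rightarrow> ('v, 'a) qpath set"
where
  "Gamma_tilde K Q \<alpha> \<zeta> = Gamma K Q \<alpha> \<zeta> \<union>
     {(Vertex (tail Q a), Arrow a # p) | a p.
        a \<in> arcs Q \<and> (Vertex (head Q a), p) \<in> Gamma K Q \<alpha> \<zeta>}"

text \<open>A matrix whose rows are indexed by a set of paths is an extensional family of row
  vectors.\<close>

type_synonym ('v, 'a, 'k) row_matrices = "'v \<Rightarrow> ('v, 'a) qpath \<Rightarrow> 'k vec"

definition Phi_hat ::
  "('v, 'a) pre_digraph \<Rightarrow> ('v \<Rightarrow> nat) \<Rightarrow> ('v \<Rightarrow> nat) \<Rightarrow> ('v, 'a, 'k :: field) framed \<Rightarrow>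
   ('v, 'a, 'k) row_matrices" where
  "Phi_hat Q \<alpha> \<zeta> Mf =
     (\<lambda>i\<in>verts Q. \<lambda>\<pi>\<in>paths_at (Gamma_tilde TYPE('k) Q \<alpha> \<zeta>) i. row (path_mat Q \<alpha> \<zeta> Mf \<pi>) 0)"

definition skeleton_minor_mat ::
  "('v \<Rightarrow> nat) \<Rightarrow> ('v, 'a) path_order \<Rightarrow> ('v, 'a) qpath set \<Rightarrow>
   ('v, 'a, 'k :: field) row_matrices \<Rightarrow> 'v \<Rightarrow> 'k mat" where
  "skeleton_minor_mat \<alpha> ord S B i = mat_of_rows (\<alpha> i) (map (B i) (ord S i))"

definition skeleta_by_minors ::
  "('v, 'a) pre_digraph \<Rightarrow> ('v \<Rightarrow> nat) \<Rightarrow> ('v \<Rightarrow> nat) \<Rightarrow> ('v, 'a) path_order \<Rightarrow>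
   ('v, 'a, 'k :: field) row_matrices \<Rightarrow> ('v, 'a) qpath set set" where
  "skeleta_by_minors Q \<alpha> \<zeta> ord B =
     {S \<in> J_skeleta_of_dim TYPE('k) Q \<alpha> \<zeta>.
        \<forall>i\<in>verts Q. det (skeleton_minor_mat \<alpha> ord S B i) \<noteq> 0}"

section \<open>Normal forms\<close>

definition hat_skeleton ::
  "('v, 'a) pre_digraph \<Rightarrow> ('v \<Rightarrow> nat) \<Rightarrow> ('v, 'a) qpath set \<Rightarrow> 'v \<Rightarrow> ('v, 'a) qpath set" where
  "hat_skeleton Q \<zeta> S i =
     ({(Vertex i, Arrow a # p) | a p.
         a \<in> arcs Q \<and> tail Q a = i \<and> (Vertex (head Q a), p) \<in> S} \<union>
      {(Vertex i, [Frame i q]) | q. q < \<zeta> i}) - S"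

text \<open>The row vector \<open>v A\<close> is \<open>A\<^sup>T v\<close>, and the row of \<open>B X\<close> indexed by \<open>\<pi>\<close> is \<open>B\<^sub>\<pi> X\<close>.\<close>

definition pi_skeleton ::
  "('v, 'a) pre_digraph \<Rightarrow> ('v \<Rightarrow> nat) \<Rightarrow> ('v \<Rightarrow> nat) \<Rightarrow> ('v, 'a) path_order \<Rightarrow>
   ('v, 'a) qpath set \<Rightarrow> ('v, 'a, 'k :: field) framed \<Rightarrow> ('v, 'a, 'k) row_matrices" where
  "pi_skeleton Q \<alpha> \<zeta> ord S Mf =
     (let B = Phi_hat Q \<alpha> \<zeta> Mf in
       (\<lambda>i\<in>verts Q. \<lambda>\<pi>\<in>hat_skeleton Q \<zeta> S i.
         transpose_mat (mat_inv (skeleton_minor_mat \<alpha> ord S B i)) *\<^sub>v B i \<pi>))"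

definition E_row ::
  "('v \<Rightarrow> nat) \<Rightarrow> ('v, 'a) path_order \<Rightarrow> ('v, 'a) qpath set \<Rightarrow> 'v \<Rightarrow> ('v, 'a) qpath \<Rightarrow>
   'k :: field vec" where
  "E_row \<alpha> ord S i \<pi> =
     row (1\<^sub>m (\<alpha> i)) (THE r. r < length (ord S i) \<and> ord S i ! r = \<pi>)"

definition nf_row ::
  "('v \<Rightarrow> nat) \<Rightarrow> ('v, 'a) path_order \<Rightarrow> ('v, 'a) qpath set \<Rightarrow>
   ('v, 'a, 'k :: field) row_matrices \<Rightarrow> 'v \<Rightarrow> ('v, 'a) qpath \<Rightarrow> 'k vec" where
  "nf_row \<alpha> ord S C i \<pi> = (if \<pi> \<in> S then E_row \<alpha> ord S i \<pi> else C i \<pi>)"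

definition nf_pair ::
  "('v, 'a) pre_digraph \<Rightarrow> ('v \<Rightarrow> nat) \<Rightarrow> ('v \<Rightarrow> nat) \<Rightarrow> ('v, 'a) path_order \<Rightarrow>
   ('v, 'a) qpath set \<Rightarrow> ('v, 'a, 'k :: field) row_matrices \<Rightarrow> ('v, 'a, 'k) framed" where
  "nf_pair Q \<alpha> \<zeta> ord S C =
     (\<lambda>a\<in>arcs Q. mat_of_rows (\<alpha> (tail Q a))
        (map (\<lambda>\<tau>. nf_row \<alpha> ord S C (tail Q a) (Vertex (tail Q a), Arrow a # snd \<tau>))
          (ord S (head Q a))),
      \<lambda>i\<in>verts Q. mat_of_rows (\<alpha> i)
        (map (\<lambda>q. nf_row \<alpha> ord S C i (Vertex i, [Frame i q])) [0..<\<zeta> i]))"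

definition normal_form ::
  "('v, 'a) pre_digraph \<Rightarrow> ('v \<Rightarrow> nat) \<Rightarrow> ('v \<Rightarrow> nat) \<Rightarrow> ('v, 'a) path_order \<Rightarrow>
   ('v, 'a) qpath set \<Rightarrow> ('v, 'a, 'k :: field) framed \<Rightarrow> ('v, 'a, 'k) framed" where
  "normal_form Q \<alpha> \<zeta> ord S Mf = nf_pair Q \<alpha> \<zeta> ord S (pi_skeleton Q \<alpha> \<zeta> ord S Mf)"

end

theory Submission
  imports Defs
begin

text \<open>A path from \<open>i\<close> to \<open>\<infinity>\<close> acts on \<open>\<Bbbk>\<^bsup>\<alpha>\<^sub>i\<^esup>\<close> as a row vector. The image of \<open>\<Phi>\<close> is a copy of the
  product of these spaces, as stability says exactly that the rows of all paths separate points.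
  So a set of paths restricts to a basis of the dual of the image iff at every vertex its rows form
  a basis, i.e. iff all \<open>B(\<SS>\<^sub>i)\<close> are square and nonsingular. The tuple \<open>g = (B(\<SS>\<^sub>i))\<^sub>i\<close> then lies
  in \<open>GL(\<alpha>)\<close>, and the normal form is \<open>g \<cdot> (M, f)\<close>. Since \<open>h \<in> GL(\<alpha>)\<close> changes \<open>B(\<SS>\<^sub>i)\<close> into
  \<open>B(\<SS>\<^sub>i) h\<^sub>i\<^sup>-\<^sup>1\<close>, the skeleta and the normal forms depend on the orbit only. Skeleta
  exist: for a maximal suffix-closed set of paths with independent rows, the common kernel of the
  rows is a subrepresentation contained in \<open>ker f\<close>, hence zero.\<close>

section \<open>Families of vectors\<close>

text \<open>Three obstacles shape the details. \<open>Phi_hat\<close> is unspecified outside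
  \<Gamma>~, yet the normal form also reads the rows of frame arrows outside \<SS>. If \<alpha>_i
  \<noteq> 0, each such arrow at i belongs to a skeleton of some stable pair, though perhaps not of
  the given one, so its row is present in B. If \<alpha>_i = 0, a row has no coordinates and its
  unspecified value does no harm. Finiteness is not part of the definition of a skeleton, and over
  an infinite field infinitely many pairs may contribute to \<Gamma>(\<alpha>). Closure under
  suffixes gives a bound that is uniform in the pair: a path of length l forces l paths into \<SS>,
  so l is at most the sum of all \<alpha>_i. Finally, J~ is infinite-dimensional as soon as
  infinitely many paths reach \<infinity>. No dimension count is made there: functionals on the
  image are tested on points \<Phi>(x), and rows are compared by pairing them with vectors.\<close>

definition indep_fam :: "nat \<Rightarrow> ('b \<Rightarrow> 'k :: field vec) \<Rightarrow> 'b set \<Rightarrow> bool" where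
  "indep_fam n v P \<longleftrightarrow>
     (\<forall>A c. finite A \<longrightarrow> A \<subseteq> P \<longrightarrow> (\<forall>j<n. (\<Sum>p\<in>A. c p * v p $ j) = 0) \<longrightarrow> (\<forall>p\<in>A. c p = 0))"

text \<open>Spanning in dual form: vectors span the n-dimensional space iff only zero is annihilated
  by all of them. Stability, a statement about common kernels, yields the property in exactly this
  form.\<close>

definition sep_fam :: "nat \<Rightarrow> ('b \<Rightarrow> 'k :: field vec) \<Rightarrow> 'b set \<Rightarrow> bool" where
  "sep_fam n v P \<longleftrightarrow> (\<forall>y\<in>carrier_vec n. (\<forall>p\<in>P. v p \<bullet> y = 0) \<longrightarrow> y = 0\<^sub>v n)"

lemma indep_famD:
  assumes "indep_fam n v P" "finite A" "A \<subseteq> P" "\<And>j. j < n \<Longrightarrow> (\<Sum>p\<in>A. c p * v p $ j) = 0" "p \<in> A"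
  shows "c p = 0"
  using assms unfolding indep_fam_def by blast

lemma sep_famD:
  "sep_fam n v P \<Longrightarrow> y \<in> carrier_vec n \<Longrightarrow> (\<And>p. p \<in> P \<Longrightarrow> v p \<bullet> y = 0) \<Longrightarrow> y = 0\<^sub>v n"
  unfolding sep_fam_def by blast

lemma indep_fam_mono: "indep_fam n v P \<Longrightarrow> P' \<subseteq> P \<Longrightarrow> indep_fam n v P'"
  unfolding indep_fam_def by (meson subset_trans)

lemma injective_mat_imp_le:
  fixes A :: "'k :: field mat"
  assumes A: "A \<in> carrier_mat n k"
    and inj: "\<And>x. x \<in> carrier_vec k \<Longrightarrow> A *\<^sub>v x = 0\<^sub>v n \<Longrightarrow> x = 0\<^sub>v k"
  shows "k \<le> n"
proof (rule ccontr)
  assume "\<not> k \<le> n"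
  then have nk: "n < k" by simp
  \<comment> \<open>Zero rows fill \<open>A\<close> up to a square matrix with the same kernel. Row
    n is one of them, so the unit vector at n is killed by the transpose and the determinant
    vanishes.\<close>
  define B where "B = mat k k (\<lambda>(i, j). if i < n then A $$ (i, j) else 0)"
  have B: "B \<in> carrier_mat k k" by (simp add: B_def)
  have "transpose_mat B *\<^sub>v unit_vec k n = 0\<^sub>v k"
    using nk by (intro eq_vecI) (auto simp: B_def col_def)
  moreover have "unit_vec k n \<noteq> (0\<^sub>v k :: 'k vec)"
    using nk by (metis index_unit_vec(1) index_zero_vec(1) one_neq_zero)
  ultimately have "det (transpose_mat B) = 0"
    using det_0_iff_vec_prod_zero_field[of "transpose_mat B" k] B by (auto intro: unit_vec_carrier)
  then have "det B = 0" using det_transpose[OF B] by simp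
  then obtain x where x: "x \<in> carrier_vec k" "x \<noteq> 0\<^sub>v k" "B *\<^sub>v x = 0\<^sub>v k"
    using det_0_iff_vec_prod_zero_field[OF B] by blast
  have "A *\<^sub>v x = 0\<^sub>v n"
  proof (rule eq_vecI)
    fix i assume i: "i < dim_vec (0\<^sub>v n :: 'k vec)"
    have "row A i = row B i" using i nk A by (intro eq_vecI) (auto simp: B_def)
    moreover have "(B *\<^sub>v x) $ i = 0" using x i nk by simp
    ultimately show "(A *\<^sub>v x) $ i = 0\<^sub>v n $ i" using i A B nk by auto
  qed (use A in auto)
  with inj x show False by blast
qed

lemma indep_fam_iff_mat:
  fixes v :: "'b \<Rightarrow> 'k :: field vec"
  assumes "distinct L" "set L = P" and v: "\<And>p. p \<in> P \<Longrightarrow> v p \<in> carrier_vec n"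
  shows "indep_fam n v P \<longleftrightarrow>
    (\<forall>x\<in>carrier_vec (length L). transpose_mat (mat_of_rows n (map v L)) *\<^sub>v x = 0\<^sub>v n \<longrightarrow> x = 0\<^sub>v (length L))"
    (is "_ \<longleftrightarrow> ?R")
proof -
  let ?A = "mat_of_rows n (map v L)"
  have P: "finite P" using assms by auto
  have sum: "(transpose_mat ?A *\<^sub>v x) $ j = (\<Sum>r<length L. x $ r * v (L ! r) $ j)"
    if "x \<in> carrier_vec (length L)" "j < n" for x j
    using that by (auto simp: scalar_prod_def mat_of_rows_index atLeast0LessThan mult.commute intro!: sum.cong)
  have reindex: "(\<Sum>r<length L. g (L ! r)) = (\<Sum>p\<in>P. g p)" for g :: "'b \<Rightarrow> 'k"
    using sum.reindex_bij_betw[OF bij_betw_nth[OF assms(1) refl assms(2)[symmetric]], of g] .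
  show ?thesis
  proof
    assume ind: "indep_fam n v P"
    show ?R
    proof safe
      fix x assume x: "x \<in> carrier_vec (length L)" "transpose_mat ?A *\<^sub>v x = 0\<^sub>v n"
      \<comment> \<open>The position of \<open>p\<close> in \<open>L\<close> is unique because
        \<open>L\<close> is distinct; thus a coefficient vector becomes a coefficient function on
        \<open>P\<close>.\<close>
      define c where "c p = x $ (THE r. r < length L \<and> L ! r = p)" for p
      have c: "c (L ! r) = x $ r" if "r < length L" for r
      proof -
        have "(THE r'. r' < length L \<and> L ! r' = L ! r) = r"
          using that assms(1) by (intro the_equality) (auto simp: nth_eq_iff_index_eq)
        then show ?thesis by (simp add: c_def)
      qed
      have "(\<Sum>p\<in>P. c p * v p $ j) = 0" if "j < n" for j
        using sum[OF x(1) that] x(2) that c by (subst reindex[symmetric]) (auto simp flip: lessThan_iff)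
      then have "c p = 0" if "p \<in> P" for p
        using indep_famD[OF ind P subset_refl _ that] by blast
      then show "x = 0\<^sub>v (length L)"
        using x c assms(2) by (intro eq_vecI) (auto simp: all_set_conv_all_nth)
    qed
  next
    assume R: ?R
    show "indep_fam n v P"
      unfolding indep_fam_def
    proof safe
      fix A c p assume A: "finite A" "A \<subseteq> P" "\<forall>j<n. (\<Sum>p\<in>A. c p * v p $ j) = 0" "p \<in> A"
      \<comment> \<open>A relation on the finite subset \<open>A\<close> is extended by zero to all
        of \<open>P\<close>.\<close>
      define x where "x = vec (length L) (\<lambda>r. if L ! r \<in> A then c (L ! r) else 0)"
      have "transpose_mat ?A *\<^sub>v x = 0\<^sub>v n"
      proof (rule eq_vecI)
        fix j assume j: "j < dim_vec (0\<^sub>v n :: 'k vec)"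
        have "(transpose_mat ?A *\<^sub>v x) $ j = (\<Sum>p\<in>P. (if p \<in> A then c p else 0) * v p $ j)"
          using j by (subst sum) (auto simp: x_def reindex[symmetric])
        also have "\<dots> = (\<Sum>p\<in>A. c p * v p $ j)"
          using A(2) P by (intro sum.mono_neutral_cong_right) auto
        finally show "(transpose_mat ?A *\<^sub>v x) $ j = 0\<^sub>v n $ j" using A(3) j by simp
      qed auto
      then have "x = 0\<^sub>v (length L)" using R by (simp add: x_def)
      moreover obtain r where "r < length L" "L ! r = p"
        using A assms(2) by (metis in_set_conv_nth subsetD)
      ultimately show "c p = 0"
        using A(4) index_vec[of r "length L" "\<lambda>r. if L ! r \<in> A then c (L ! r) else 0"]
        by (simp flip: x_def)
    qed
  qed
qed

lemma sep_fam_iff_mat: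
  fixes v :: "'b \<Rightarrow> 'k :: field vec"
  assumes "set L = P" and v: "\<And>p. p \<in> P \<Longrightarrow> v p \<in> carrier_vec n"
  shows "sep_fam n v P \<longleftrightarrow>
    (\<forall>y\<in>carrier_vec n. mat_of_rows n (map v L) *\<^sub>v y = 0\<^sub>v (length L) \<longrightarrow> y = 0\<^sub>v n)"
proof -
  have "mat_of_rows n (map v L) *\<^sub>v y = 0\<^sub>v (length L) \<longleftrightarrow> (\<forall>p\<in>P. v p \<bullet> y = 0)" for y
  proof -
    have "mat_of_rows n (map v L) *\<^sub>v y = 0\<^sub>v (length L) \<longleftrightarrow> (\<forall>r<length L. row (mat_of_rows n (map v L)) r \<bullet> y = 0)"
      by (auto simp: vec_eq_iff)
    also have "\<dots> \<longleftrightarrow> (\<forall>r<length L. v (L ! r) \<bullet> y = 0)"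
      using assms by (intro all_cong) (auto)
    also have "\<dots> \<longleftrightarrow> (\<forall>p\<in>P. v p \<bullet> y = 0)"
      unfolding assms(1)[symmetric] all_set_conv_all_nth ..
    finally show ?thesis .
  qed
  then show ?thesis by (simp add: sep_fam_def)
qed

text \<open>\<open>P\<close> may be infinite a priori. The bound is proved for finite subsets, and
  an infinite set would contain one with n + 1 elements.\<close>

lemma indep_fam_card_le:
  fixes v :: "'b \<Rightarrow> 'k :: field vec"
  assumes "indep_fam n v P" and v: "\<And>p. p \<in> P \<Longrightarrow> v p \<in> carrier_vec n"
  shows "finite P" "card P \<le> n"
proof -
  have *: "card A \<le> n" if A: "finite A" "A \<subseteq> P" for A
  proof -
    obtain L where L: "distinct L" "set L = A" using finite_distinct_list[OF A(1)] by blast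
    have "indep_fam n v A" using assms(1) A(2) by (rule indep_fam_mono)
    then have "length L \<le> n"
      using indep_fam_iff_mat[OF L, where v = v and n = n] v A
      by (intro injective_mat_imp_le[of "transpose_mat (mat_of_rows n (map v L))"]) auto
    then show ?thesis using L distinct_card by metis
  qed
  show "finite P" using * infinite_arbitrarily_large[of P "Suc n"] by fastforce
  then show "card P \<le> n" using * by blast
qed

text \<open>Independence is injectivity of the transposed matrix, separation is injectivity of the
  matrix itself. Each forces one inequality between the number of rows and n, so together they make
  the matrix square, and then either injectivity amounts to a nonzero determinant.\<close>

lemma indep_sep_iff_det:
  fixes v :: "'b \<Rightarrow> 'k :: field vec"
  assumes L: "distinct L" "set L = P" and v: "\<And>p. p \<in> P \<Longrightarrow> v p \<in> carrier_vec n"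
  shows "indep_fam n v P \<and> sep_fam n v P \<longleftrightarrow>
    length L = n \<and> det (mat_of_rows n (map v L)) \<noteq> 0"
proof -
  let ?A = "mat_of_rows n (map v L)"
  have A: "?A \<in> carrier_mat (length L) n" by (metis length_map mat_of_rows_carrier(1))
  note ind = indep_fam_iff_mat[where v = v and n = n, OF L v]
    and sep = sep_fam_iff_mat[where v = v and n = n, OF L(2) v]
  show ?thesis
  proof
    assume *: "indep_fam n v P \<and> sep_fam n v P"
    have "n \<le> length L" using * sep by (intro injective_mat_imp_le[OF A]) auto
    moreover have "card P \<le> n" using * v by (intro indep_fam_card_le(2)[where v = v and n = n]) auto
    then have "length L \<le> n" using L distinct_card[OF L(1)] by simp
    ultimately have len: "length L = n" by simp
    have "\<forall>y\<in>carrier_vec n. ?A *\<^sub>v y = 0\<^sub>v n \<longrightarrow> y = 0\<^sub>v n"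
      using sep * unfolding len by blast
    then show "length L = n \<and> det ?A \<noteq> 0"
      using det_0_iff_vec_prod_zero_field[OF A[unfolded len]] len by blast
  next
    assume *: "length L = n \<and> det ?A \<noteq> 0"
    then have A': "?A \<in> carrier_mat n n" "transpose_mat ?A \<in> carrier_mat n n"
      and d: "det (transpose_mat ?A) \<noteq> 0"
      using A det_transpose[of ?A n] by auto
    have "\<forall>y\<in>carrier_vec n. ?A *\<^sub>v y = 0\<^sub>v n \<longrightarrow> y = 0\<^sub>v n"
      using det_0_iff_vec_prod_zero_field[OF A'(1)] * by blast
    moreover have "\<forall>y\<in>carrier_vec n. transpose_mat ?A *\<^sub>v y = 0\<^sub>v n \<longrightarrow> y = 0\<^sub>v n"
      using det_0_iff_vec_prod_zero_field[OF A'(2)] d by blast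
    ultimately show "indep_fam n v P \<and> sep_fam n v P"
      using * ind sep by simp
  qed
qed

lemma mat_inv_mult:
  fixes A :: "'k :: field mat"
  assumes A: "A \<in> carrier_mat n n" and d: "det A \<noteq> 0"
  shows "mat_inv A \<in> carrier_mat n n" "A * mat_inv A = 1\<^sub>m n" "mat_inv A * A = 1\<^sub>m n"
proof -
  have "A \<in> Units (ring_mat TYPE('k) n ())" using A d by (rule det_non_zero_imp_unit)
  then obtain B where "mat_inverse A = Some B" 
    using mat_inverse(1)[OF A, where b = "()"] by (cases "mat_inverse A") auto
  then show "mat_inv A \<in> carrier_mat n n" "A * mat_inv A = 1\<^sub>m n" "mat_inv A * A = 1\<^sub>m n"
    using mat_inverse(2)[OF A] by (auto simp: mat_inv_def)
qed

text \<open>The dual basis consists of the columns of the inverse of the matrix with rows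
  \<open>v p\<close>.\<close>

lemma dual_family:
  fixes v :: "'b \<Rightarrow> 'k :: field vec"
  assumes "indep_fam n v P" "sep_fam n v P" and v: "\<And>p. p \<in> P \<Longrightarrow> v p \<in> carrier_vec n"
  obtains y where "\<And>p. p \<in> P \<Longrightarrow> y p \<in> carrier_vec n"
    "\<And>p q. p \<in> P \<Longrightarrow> q \<in> P \<Longrightarrow> v p \<bullet> y q = (if p = q then 1 else 0)"
proof -
  have "finite P" using indep_fam_card_le(1)[OF assms(1) v] .
  then obtain L where L: "distinct L" "set L = P" using finite_distinct_list by blast
  define A where "A = mat_of_rows n (map v L)"
  have len: "length L = n" and d: "det A \<noteq> 0"
    using indep_sep_iff_det[where v = v and n = n, OF L] assms by (auto simp: A_def)
  have A: "A \<in> carrier_mat n n" unfolding A_def using len by (metis length_map mat_of_rows_carrier(1))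
  note inv = mat_inv_mult[OF A d]
  define ix where "ix p = (THE r. r < n \<and> L ! r = p)" for p
  have ix: "ix p < n \<and> L ! ix p = p" if "p \<in> P" for p
    using theI'[OF distinct_Ex1[OF L(1), of p]] that L(2) len by (simp add: ix_def)
  define y where "y p = col (mat_inv A) (ix p)" for p
  show thesis
  proof
    fix p assume "p \<in> P"
    then show "y p \<in> carrier_vec n" using inv(1) by (auto simp: y_def)
  next
    fix p q assume pq: "p \<in> P" "q \<in> P"
    have "row A (ix p) = v (L ! ix p)"
      unfolding A_def using ix[OF pq(1)] len v[OF pq(1)] by (subst mat_of_rows_row) auto
    then have "v p = row A (ix p)" using ix[OF pq(1)] by simp
    then have "v p \<bullet> y q = row A (ix p) \<bullet> col (mat_inv A) (ix q)" by (simp only: y_def)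
    also have "\<dots> = (A * mat_inv A) $$ (ix p, ix q)"
      using ix[OF pq(1)] ix[OF pq(2)] A inv(1) by (subst index_mult_mat(1)) auto
    also have "\<dots> = (if p = q then 1 else 0)"
    proof -
      have "ix p = ix q \<longleftrightarrow> p = q" using ix[OF pq(1)] ix[OF pq(2)] by metis
      then show ?thesis
        using conjunct1[OF ix[OF pq(1)]] conjunct1[OF ix[OF pq(2)]] by (simp add: inv(2))
    qed
    finally show "v p \<bullet> y q = (if p = q then 1 else 0)" .
  qed
qed

text \<open>The vector \<open>y\<close> certifies that \<open>v p\<close> is outside the span of the
  old family: pairing a relation with \<open>y\<close> leaves only the term of \<open>p\<close>, so
  its coefficient vanishes.\<close>

lemma indep_fam_insert:
  fixes v :: "'b \<Rightarrow> 'k :: field vec"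
  assumes ind: "indep_fam n v P" and fin: "finite P" and p: "p \<notin> P"
    and vc: "v p \<in> carrier_vec n" "\<And>q. q \<in> P \<Longrightarrow> v q \<in> carrier_vec n"
    and y: "y \<in> carrier_vec n" "\<And>q. q \<in> P \<Longrightarrow> v q \<bullet> y = 0" "v p \<bullet> y \<noteq> 0"
  shows "indep_fam n v (insert p P)"
  unfolding indep_fam_def
proof (intro allI impI)
  fix A c assume A: "finite A" "A \<subseteq> insert p P" "\<forall>j<n. (\<Sum>q\<in>A. c q * v q $ j) = 0"
  have v: "v q \<in> carrier_vec n" if "q \<in> A" for q using that A vc by auto
  have "0 = (\<Sum>j<n. (\<Sum>q\<in>A. c q * v q $ j) * y $ j)" using A(3) by simp
  also have "\<dots> = (\<Sum>q\<in>A. c q * (v q \<bullet> y))"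
    using y(1) unfolding sum_distrib_right scalar_prod_def sum_distrib_left
    by (subst sum.swap) (auto intro!: sum.cong simp: mult.assoc atLeast0LessThan)
  also have "\<dots> = (\<Sum>q\<in>A. if q = p then c p * (v p \<bullet> y) else 0)"
    using A(2) y(2) by (intro sum.cong) auto
  also have "\<dots> = (if p \<in> A then c p * (v p \<bullet> y) else 0)" using A(1) by simp
  finally have cp: "p \<in> A \<Longrightarrow> c p = 0" using y(3) by auto
  have "(\<Sum>q\<in>A - {p}. c q * v q $ j) = 0" if "j < n" for j
    using A(1,3) that cp by (cases "p \<in> A") (auto simp: sum.remove[of A p])
  then have "c q = 0" if "q \<in> A - {p}" for q
    using indep_famD[OF ind, of "A - {p}" c q] that A by auto
  then show "\<forall>q\<in>A. c q = 0" using cp by auto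
qed

section \<open>Bases of dual spaces\<close>

lemma ring_class_ring: "ring (class_ring :: 'k :: field ring)"
  by (rule cring.axioms(1)[OF fieldE(1)[OF class_field]])

lemma dual_vs_simps [simp]:
  "zero (dual_vs V) = (\<lambda>x\<in>carrier V. 0)"
  "add (dual_vs V) = (\<lambda>f g. \<lambda>x\<in>carrier V. f x + g x)"
  "smult (dual_vs V) = (\<lambda>c f. \<lambda>x\<in>carrier V. c * f x)"
  by (simp_all add: dual_vs_def ring.func_space_def[OF ring_class_ring] class_ring_simps)

lemma dual_vs_carrier:
  "f \<in> carrier (dual_vs V) \<longleftrightarrow> f \<in> extensional (carrier V) \<and>
     (\<forall>x\<in>carrier V. \<forall>y\<in>carrier V. f (x \<oplus>\<^bsub>V\<^esub> y) = f x + f y) \<and>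
     (\<forall>c. \<forall>x\<in>carrier V. f (c \<odot>\<^bsub>V\<^esub> x) = c * f x)"
  by (auto simp: dual_vs_def module_hom_def field_vs_def class_ring_simps)

text \<open>Closure under the operations suffices: the functionals form a submodule of the space of
  all functions on the carrier, and the vector space laws of the dual are inherited from there. So
  the laws need not be verified for the image of \<Phi>.\<close>

locale closed_carrier =
  fixes V :: "('k :: field, 'x, 'm) module_scheme"
  assumes nonempty: "carrier V \<noteq> {}"
    and add_closed: "\<And>x y. x \<in> carrier V \<Longrightarrow> y \<in> carrier V \<Longrightarrow> x \<oplus>\<^bsub>V\<^esub> y \<in> carrier V"
    and smult_closed: "\<And>c x. x \<in> carrier V \<Longrightarrow> c \<odot>\<^bsub>V\<^esub> x \<in> carrier V"
begin

lemma vectorspace_dual: "vectorspace class_ring (dual_vs V)"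
proof -
  let ?F = "ring.func_space (class_ring :: 'k ring) (carrier V)"
  interpret F: module "class_ring :: 'k ring" ?F by (rule cring.func_space_is_module) (rule fieldE(1)[OF class_field])
  have "submodule class_ring (carrier (dual_vs V)) ?F"
  proof
    show "carrier (dual_vs V) \<subseteq> carrier ?F"
      by (auto simp: dual_vs_carrier ring.func_space_def[OF ring_class_ring] class_ring_simps extensional_def)
    show "\<zero>\<^bsub>?F\<^esub> \<in> carrier (dual_vs V)"
      by (auto simp: dual_vs_carrier ring.func_space_def[OF ring_class_ring] class_ring_simps add_closed smult_closed)
    show "f \<oplus>\<^bsub>?F\<^esub> g \<in> carrier (dual_vs V)"
      if "f \<in> carrier (dual_vs V)" "g \<in> carrier (dual_vs V)" for f g
      using that by (auto simp: dual_vs_carrier ring.func_space_def[OF ring_class_ring] class_ring_simps add_closed smult_closed algebra_simps)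
    show "c \<odot>\<^bsub>?F\<^esub> f \<in> carrier (dual_vs V)" if "f \<in> carrier (dual_vs V)" for c f
      using that by (auto simp: dual_vs_carrier ring.func_space_def[OF ring_class_ring] class_ring_simps add_closed smult_closed algebra_simps)
  qed
  from F.submodule_is_module[OF this] have "module class_ring (?F\<lparr>carrier := carrier (dual_vs V)\<rparr>)" .
  also have "?F\<lparr>carrier := carrier (dual_vs V)\<rparr> = dual_vs V" by (simp add: dual_vs_def)
  finally show ?thesis using class_field by (simp add: vectorspace_def)
qed

lemma lincomb_dual:
  assumes "finite A" "A \<subseteq> carrier (dual_vs V)"
  shows "module.lincomb (dual_vs V) a A = (\<lambda>x\<in>carrier V. \<Sum>f\<in>A. a f * f x)"
proof -
  interpret D: vectorspace class_ring "dual_vs V" by (rule vectorspace_dual)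
  show ?thesis
    using assms
  proof (induction A rule: finite_induct)
    case empty
    then show ?case by (simp add: D.lincomb_def)
  next
    case (insert f A)
    have "a g \<odot>\<^bsub>dual_vs V\<^esub> g \<in> carrier (dual_vs V)" if "g \<in> insert f A" for g
      using that insert.prems by (intro D.smult_closed) (auto simp: class_ring_simps)
    then have "D.lincomb a (insert f A) = a f \<odot>\<^bsub>dual_vs V\<^esub> f \<oplus>\<^bsub>dual_vs V\<^esub> D.lincomb a A"
      unfolding D.lincomb_def using insert.hyps by (intro D.finsum_insert) auto
    then show ?case using insert by (auto simp: fun_eq_iff)
  qed
qed

text \<open>A basis is a set of functionals, whereas coefficients are wanted per index (later: per
  path). Injectivity of the indexing makes the two views interchangeable, and it is itself a
  consequence of independence of the family.\<close>

lemma dual_basis_iff: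
  fixes r :: "'p \<Rightarrow> 'x \<Rightarrow> 'k"
  assumes r: "\<And>p. p \<in> P \<Longrightarrow> r p \<in> carrier (dual_vs V)"
  shows "inj_on r P \<and> vectorspace.basis class_ring (dual_vs V) (r ` P) \<longleftrightarrow>
    (\<forall>A c. finite A \<longrightarrow> A \<subseteq> P \<longrightarrow> (\<forall>x\<in>carrier V. (\<Sum>p\<in>A. c p * r p x) = 0) \<longrightarrow> (\<forall>p\<in>A. c p = 0)) \<and>
    (\<forall>f\<in>carrier (dual_vs V). \<exists>A c. finite A \<and> A \<subseteq> P \<and> (\<forall>x\<in>carrier V. f x = (\<Sum>p\<in>A. c p * r p x)))"
    (is "?B \<longleftrightarrow> ?I \<and> ?S")
proof -
  interpret D: vectorspace class_ring "dual_vs V" by (rule vectorspace_dual)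
  have reindex: "(\<Sum>f\<in>r ` A. c f * f x) = (\<Sum>p\<in>A. c (r p) * r p x)" if "inj_on r P" "A \<subseteq> P" for A c x
    using that by (subst sum.reindex) (auto intro: inj_on_subset)
  show ?thesis
  proof
    assume B: ?B
    then have inj: "inj_on r P" and li: "\<not> D.lin_dep (r ` P)" and span: "D.span (r ` P) = carrier (dual_vs V)"
      by (auto simp: D.basis_def)
    have ?I
    proof safe
      fix A c p assume A: "finite A" "A \<subseteq> P" "\<forall>x\<in>carrier V. (\<Sum>p\<in>A. c p * r p x) = 0" "p \<in> A"
      \<comment> \<open>Injectivity of \<open>r\<close> transports coefficients from indices to
        functionals.\<close>
      define a where "a f = c (inv_into P r f)" for f
      have ar: "a (r q) = c q" if "q \<in> A" for q using that A(2) inj by (auto simp: a_def)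
      have "D.lincomb a (r ` A) = \<zero>\<^bsub>dual_vs V\<^esub>"
        using A ar r by (subst lincomb_dual) (auto simp: fun_eq_iff reindex[OF inj] subset_iff)
      then have "a (r p) = 0"
        using li A unfolding D.lin_dep_def by (auto simp: class_ring_simps subset_iff)
      then show "c p = 0" using ar A(4) by simp
    qed
    moreover have ?S
    proof
      fix f assume "f \<in> carrier (dual_vs V)"
      then obtain a F where F: "finite F" "F \<subseteq> r ` P" "f = D.lincomb a F"
        unfolding span[symmetric] D.span_def by blast
      then obtain A where A: "finite A" "A \<subseteq> P" "F = r ` A"
        by (metis finite_subset_image)
      have "f x = (\<Sum>p\<in>A. a (r p) * r p x)" if "x \<in> carrier V" for x
        using F A r that by (subst F(3), subst lincomb_dual) (auto simp: reindex[OF inj])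
      then show "\<exists>A c. finite A \<and> A \<subseteq> P \<and> (\<forall>x\<in>carrier V. f x = (\<Sum>p\<in>A. c p * r p x))"
        using A by (intro exI[of _ A] exI[of _ "\<lambda>p. a (r p)"]) auto
    qed
    ultimately show "?I \<and> ?S" ..
  next
    assume IS: "?I \<and> ?S"
    have inj: "inj_on r P"
    proof (rule inj_onI, rule ccontr)
      fix p q assume pq: "p \<in> P" "q \<in> P" "r p = r q" "p \<noteq> q"
      \<comment> \<open>Two indices with the same functional satisfy the nontrivial relation with
        coefficients 1 and -1.\<close>
      have "(\<Sum>s\<in>{p, q}. (if s = p then 1 else - 1) * r s x) = 0" for x
        using pq by simp
      then have "\<forall>s\<in>{p, q}. (if s = p then 1 else - 1 :: 'k) = 0"
        using conjunct1[OF IS, rule_format, of "{p, q}" "\<lambda>s. if s = p then 1 else - 1"] pq by blast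
      then show False by simp
    qed
    have "\<not> D.lin_dep (r ` P)"
    proof
      assume "D.lin_dep (r ` P)"
      then obtain F a f where F: "finite F" "F \<subseteq> r ` P" "D.lincomb a F = \<zero>\<^bsub>dual_vs V\<^esub>" "f \<in> F" "a f \<noteq> 0"
        unfolding D.lin_dep_def by (auto simp: class_ring_simps)
      then obtain A where A: "finite A" "A \<subseteq> P" "F = r ` A"
        by (metis finite_subset_image)
      have "(\<Sum>p\<in>A. a (r p) * r p x) = 0" if "x \<in> carrier V" for x
      proof -
        have "D.lincomb a F x = (\<Sum>p\<in>A. a (r p) * r p x)"
          using F(1,2) A r that by (subst lincomb_dual) (auto simp: reindex[OF inj])
        then show ?thesis using F(3) that by simp
      qed
      then have "\<forall>p\<in>A. a (r p) = 0"
        using conjunct1[OF IS, rule_format, of A "\<lambda>p. a (r p)"] A by blast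
      then show False using A F by auto
    qed
    moreover have "D.span (r ` P) = carrier (dual_vs V)"
    proof (intro subset_antisym subsetI)
      fix f assume "f \<in> D.span (r ` P)"
      then show "f \<in> carrier (dual_vs V)"
        using D.span_is_subset2[of "r ` P"] r by auto
    next
      fix f assume f: "f \<in> carrier (dual_vs V)"
      then obtain A c where A: "finite A" "A \<subseteq> P" "\<And>x. x \<in> carrier V \<Longrightarrow> f x = (\<Sum>p\<in>A. c p * r p x)"
        using IS by metis
      define a where "a f = c (inv_into P r f)" for f
      have ar: "a (r q) = c q" if "q \<in> A" for q using that A(2) inj by (auto simp: a_def)
      have "f = D.lincomb a (r ` A)"
      proof (subst lincomb_dual)
        show "f = (\<lambda>x\<in>carrier V. \<Sum>f\<in>r ` A. a f * f x)"
          using A ar f by (auto simp: fun_eq_iff reindex[OF inj] dual_vs_carrier extensional_def)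
      qed (use A r in auto)
      then show "f \<in> D.span (r ` P)"
        unfolding D.span_def using A by (auto simp: class_ring_simps)
    qed
    ultimately show ?B
      using inj r by (auto simp: D.basis_def)
  qed
qed

text \<open>The point \<open>x\<close> is the linear combination of the \<open>w p\<close>, but as
  no vector space laws of \<open>V\<close> are at hand it is described only through the values of
  functionals. The empty combination is 0 times an arbitrary point, where homogeneity makes every
  functional vanish.\<close>

lemma dual_combination:
  assumes "finite A" "\<And>p. p \<in> A \<Longrightarrow> w p \<in> carrier V"
  obtains x where "x \<in> carrier V" "\<And>f. f \<in> carrier (dual_vs V) \<Longrightarrow> f x = (\<Sum>p\<in>A. c p * f (w p))"
proof -
  have "\<exists>x\<in>carrier V. \<forall>f\<in>carrier (dual_vs V). f x = (\<Sum>p\<in>A. c p * f (w p))"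
    using assms
  proof (induction A rule: finite_induct)
    case empty
    obtain x where "x \<in> carrier V" using nonempty by blast
    then show ?case
      by (intro bexI[of _ "0 \<odot>\<^bsub>V\<^esub> x"]) (auto simp: dual_vs_carrier smult_closed)
  next
    case (insert p A)
    then obtain x where "x \<in> carrier V" "\<forall>f\<in>carrier (dual_vs V). f x = (\<Sum>p\<in>A. c p * f (w p))"
      by auto
    then show ?case
      using insert
      by (intro bexI[of _ "c p \<odot>\<^bsub>V\<^esub> w p \<oplus>\<^bsub>V\<^esub> x"]) (auto simp: dual_vs_carrier smult_closed add_closed)
  qed
  then show thesis using that by blast
qed

end

section \<open>Paths and rows\<close>

lemma ext_quiver_simps [simp]:
  "verts (ext_quiver Q \<zeta>) = insert Infinity (Vertex ` verts Q)"
  "arcs (ext_quiver Q \<zeta>) = Arrow ` arcs Q \<union> {Frame i q | i q. i \<in> verts Q \<and> q < \<zeta> i}"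
  "tail (ext_quiver Q \<zeta>) (Arrow a) = Vertex (tail Q a)"
  "tail (ext_quiver Q \<zeta>) (Frame i q) = Vertex i"
  "head (ext_quiver Q \<zeta>) (Arrow a) = Vertex (head Q a)"
  "head (ext_quiver Q \<zeta>) (Frame i q) = Infinity"
  by (auto simp: ext_quiver_def)

lemma free_vs_carrier [simp]: "carrier (free_vs X) = {p. Poly_Mapping.keys p \<subseteq> X}"
  by (simp add: free_vs_def)

lemma product_vs_simps [simp]:
  "carrier (product_vs I V) = (\<Pi>\<^sub>E i\<in>I. carrier (V i))"
  "add (product_vs I V) = (\<lambda>x y. \<lambda>i\<in>I. x i \<oplus>\<^bsub>V i\<^esub> y i)"
  "smult (product_vs I V) = (\<lambda>c x. \<lambda>i\<in>I. c \<odot>\<^bsub>V i\<^esub> x i)"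
  by (simp_all add: product_vs_def)

locale framed_quiver = fin_digraph Q
  for Q :: "('v, 'a) pre_digraph" +
  fixes \<alpha> \<zeta> :: "'v \<Rightarrow> nat"
begin

abbreviation ext_verts :: "'v ext_vertex set" where
  "ext_verts \<equiv> insert Infinity (Vertex ` verts Q)"

definition inf_paths :: "('v, 'a) qpath set" where
  "inf_paths = (\<Union>i. paths_to_inf Q \<zeta> i)"

definition path_row :: "('v, 'a, 'k :: field) framed \<Rightarrow> ('v, 'a) qpath \<Rightarrow> 'k vec" where
  "path_row Mf \<pi> = row (path_mat Q \<alpha> \<zeta> Mf \<pi>) 0"

abbreviation paths_from :: "('v, 'a) qpath set \<Rightarrow> 'v ext_vertex \<Rightarrow> ('v, 'a) qpath set" where
  "paths_from P i \<equiv> {\<pi> \<in> P. fst \<pi> = i}"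

lemma finite_ext_arcs: "finite (arcs (ext_quiver Q \<zeta>))"
proof -
  have eq: "{Frame i q | i q. i \<in> verts Q \<and> q < \<zeta> i} = (\<lambda>(i, q). Frame i q) ` (SIGMA i : verts Q. {..<\<zeta> i})"
    by auto
  show ?thesis unfolding ext_quiver_simps eq by simp
qed

lemma inf_paths_iff: "\<pi> \<in> inf_paths \<longleftrightarrow> \<pi> \<in> paths_to_inf Q \<zeta> (fst \<pi>)"
  by (auto simp: inf_paths_def paths_to_inf_def)

lemma paths_to_inf_eq: "paths_to_inf Q \<zeta> i = paths_from inf_paths i"
  by (auto simp: inf_paths_iff paths_to_inf_def)

lemma inf_paths_simps [simp]:
  "(i, []) \<in> inf_paths \<longleftrightarrow> i = Infinity"
  "(i, Arrow a # p) \<in> inf_paths \<longleftrightarrow>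
     i = Vertex (tail Q a) \<and> a \<in> arcs Q \<and> (Vertex (head Q a), p) \<in> inf_paths"
  "(i, Frame j q # p) \<in> inf_paths \<longleftrightarrow> i = Vertex j \<and> j \<in> verts Q \<and> q < \<zeta> j \<and> p = []"
  by (auto simp: inf_paths_iff paths_to_inf_def pre_digraph.awalk_def pre_digraph.cas.simps)
    (case_tac p; auto simp: pre_digraph.cas.simps)+

lemma inf_paths_cases [consumes 1, case_names inf arrow frame]:
  assumes "\<pi> \<in> inf_paths"
  obtains "\<pi> = inf_path"
  | a p where "\<pi> = (Vertex (tail Q a), Arrow a # p)" "a \<in> arcs Q" "(Vertex (head Q a), p) \<in> inf_paths"
  | i q where "\<pi> = (Vertex i, [Frame i q])" "i \<in> verts Q" "q < \<zeta> i"
proof (cases \<pi>)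
  case (Pair i p)
  then show thesis
  proof (cases p)
    case (Cons b p')
    then show thesis using assms Pair that by (cases b) auto
  qed (use assms Pair that in \<open>auto simp: inf_path_def\<close>)
qed

lemma inf_path_in [simp]: "inf_path \<in> inf_paths"
  by (simp add: inf_path_def)

lemma inf_paths_Infinity: "\<pi> \<in> inf_paths \<Longrightarrow> fst \<pi> = Infinity \<longleftrightarrow> \<pi> = inf_path"
  by (cases rule: inf_paths_cases) (auto simp: inf_path_def)

lemma inf_paths_nonempty: "\<pi> \<in> inf_paths \<Longrightarrow> snd \<pi> \<noteq> [] \<longleftrightarrow> \<pi> \<noteq> inf_path"
  by (cases rule: inf_paths_cases) (auto simp: inf_path_def)

lemma inf_paths_tail: "\<pi> \<in> inf_paths \<Longrightarrow> fst \<pi> \<in> ext_verts"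
  by (cases rule: inf_paths_cases) (auto simp: inf_path_def)

lemma inf_paths_arcs: "\<pi> \<in> inf_paths \<Longrightarrow> set (snd \<pi>) \<subseteq> arcs (ext_quiver Q \<zeta>)"
  by (auto simp: inf_paths_iff paths_to_inf_def pre_digraph.awalk_def)

subsection \<open>Rows of path matrices\<close>

context
  fixes Mf :: "('v, 'a, 'k :: field) framed"
  assumes Mf: "Mf \<in> framed_reps Q \<alpha> \<zeta>"
begin

lemma framed_carrier [simp]:
  "a \<in> arcs Q \<Longrightarrow> fst Mf a \<in> carrier_mat (\<alpha> (head Q a)) (\<alpha> (tail Q a))"
  "i \<in> verts Q \<Longrightarrow> snd Mf i \<in> carrier_mat (\<zeta> i) (\<alpha> i)"
  using Mf by (auto simp: framed_reps_def)

lemma walk_mat_carrier: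
  "(i, p) \<in> inf_paths \<Longrightarrow> walk_mat Q \<alpha> \<zeta> Mf p i \<in> carrier_mat 1 (ext_dim \<alpha> i)"
proof (induction p arbitrary: i)
  case (Cons b p)
  show ?case
  proof (cases b)
    case (Arrow a)
    then show ?thesis
      using Cons framed_carrier(1)[of a]
      by (auto intro!: mult_carrier_mat[of _ _ "\<alpha> (head Q a)"] simp del: framed_carrier) fastforce
  next
    case (Frame j q)
    then show ?thesis using Cons by (auto intro!: mult_carrier_mat[of _ _ 1] simp: numeral_eq_Suc)
  qed
qed auto

lemma path_mat_carrier: "\<pi> \<in> inf_paths \<Longrightarrow> path_mat Q \<alpha> \<zeta> Mf \<pi> \<in> carrier_mat 1 (ext_dim \<alpha> (fst \<pi>))"
  using walk_mat_carrier[of "fst \<pi>" "snd \<pi>"] by (simp add: path_mat_def)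

lemma path_row_carrier [simp]: "\<pi> \<in> inf_paths \<Longrightarrow> path_row Mf \<pi> \<in> carrier_vec (ext_dim \<alpha> (fst \<pi>))"
  using path_mat_carrier[of \<pi>] row_carrier[of "path_mat Q \<alpha> \<zeta> Mf \<pi>" 0]
  by (simp add: path_row_def)

lemma path_mat_mult:
  "\<pi> \<in> inf_paths \<Longrightarrow> (path_mat Q \<alpha> \<zeta> Mf \<pi> *\<^sub>v x) $ 0 = path_row Mf \<pi> \<bullet> x"
  using path_mat_carrier[of \<pi>] by (auto simp: path_row_def)

lemma path_row_inf: "path_row Mf inf_path = unit_vec 1 0"
  by (auto simp: path_row_def path_mat_def inf_path_def)

lemma path_row_frame:
  assumes "i \<in> verts Q" "q < \<zeta> i"
  shows "path_row Mf (Vertex i, [Frame i q]) = row (snd Mf i) q"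
proof -
  have "row (snd Mf i) q \<in> carrier_vec (\<alpha> i)" using framed_carrier(2)[OF assms(1)] assms by auto
  then show ?thesis
    by (auto simp: path_row_def path_mat_def left_mult_one_mat[of _ 1 "\<alpha> i"])
qed

text \<open>This is the product rule for \<tau>a, stated after pairing with a vector. Taking unit
  vectors for \<open>y\<close> recovers the entries of the row.\<close>

lemma path_row_arrow:
  assumes "a \<in> arcs Q" "(Vertex (head Q a), p) \<in> inf_paths" "y \<in> carrier_vec (\<alpha> (tail Q a))"
  shows "path_row Mf (Vertex (tail Q a), Arrow a # p) \<bullet> y =
    path_row Mf (Vertex (head Q a), p) \<bullet> (fst Mf a *\<^sub>v y)"
proof -
  note 1 = walk_mat_carrier[OF assms(2)] and 2 = framed_carrier(1)[OF assms(1)]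
  have "path_row Mf (Vertex (tail Q a), Arrow a # p) \<bullet> y =
      (path_mat Q \<alpha> \<zeta> Mf (Vertex (tail Q a), Arrow a # p) *\<^sub>v y) $ 0"
    using assms by (subst path_mat_mult) auto
  also have "\<dots> = (path_mat Q \<alpha> \<zeta> Mf (Vertex (head Q a), p) *\<^sub>v (fst Mf a *\<^sub>v y)) $ 0"
    using 1 2 assms(3) by (simp add: path_mat_def)
  also have "\<dots> = path_row Mf (Vertex (head Q a), p) \<bullet> (fst Mf a *\<^sub>v y)"
    using assms by (subst path_mat_mult) auto
  finally show ?thesis .
qed

subsection \<open>Restrictions of paths to the image\<close>

abbreviation "ext_carrier \<equiv> (\<Pi>\<^sub>E i\<in>ext_verts. (carrier_vec (ext_dim \<alpha> i) :: 'k vec set))"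

lemma ext_space_carrier: "carrier (ext_space TYPE('k) Q \<alpha> \<zeta>) = ext_carrier"
  by (simp add: ext_space_def module_vec_simps)

lemma Phi_image_eq: "Phi_image Q \<alpha> \<zeta> Mf = Phi Q \<alpha> \<zeta> Mf ` ext_carrier"
  by (simp only: Phi_image_def ext_space_carrier)

lemma path_fun_Phi:
  assumes "\<pi> \<in> inf_paths"
  shows "path_fun \<pi> (Phi Q \<alpha> \<zeta> Mf x) = path_row Mf \<pi> \<bullet> x (fst \<pi>)"
  using assms inf_paths_tail[OF assms]
  by (auto simp: path_fun_def Phi_def path_mat_mult inf_paths_iff)

abbreviation "image_space \<equiv> J_space TYPE('k) Q \<zeta> \<lparr>carrier := Phi_image Q \<alpha> \<zeta> Mf\<rparr>"

lemma J_space_ops: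
  assumes "i \<in> ext_verts" "Poly_Mapping.keys p \<subseteq> paths_to_inf Q \<zeta> i"
  shows "(x \<oplus>\<^bsub>J_space TYPE('k) Q \<zeta>\<^esub> y) i p = x i p + y i p"
    "(c \<odot>\<^bsub>J_space TYPE('k) Q \<zeta>\<^esub> x) i p = c * x i p"
  using assms by (auto simp: J_space_def)

lemma Phi_add:
  assumes x: "x \<in> ext_carrier" and y: "y \<in> ext_carrier"
  shows "Phi Q \<alpha> \<zeta> Mf x \<oplus>\<^bsub>J_space TYPE('k) Q \<zeta>\<^esub> Phi Q \<alpha> \<zeta> Mf y =
    Phi Q \<alpha> \<zeta> Mf (\<lambda>i\<in>ext_verts. x i + y i)"
proof -
  have *: "(\<Sum>\<pi>\<in>Poly_Mapping.keys p. Poly_Mapping.lookup p \<pi> * (path_mat Q \<alpha> \<zeta> Mf \<pi> *\<^sub>v (x i + y i)) $ 0) =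
    (\<Sum>\<pi>\<in>Poly_Mapping.keys p. Poly_Mapping.lookup p \<pi> * (path_mat Q \<alpha> \<zeta> Mf \<pi> *\<^sub>v x i) $ 0) +
    (\<Sum>\<pi>\<in>Poly_Mapping.keys p. Poly_Mapping.lookup p \<pi> * (path_mat Q \<alpha> \<zeta> Mf \<pi> *\<^sub>v y i) $ 0)"
    if i: "i \<in> ext_verts" and p: "Poly_Mapping.keys p \<subseteq> paths_to_inf Q \<zeta> i" for i p
  proof -
    have "path_row Mf \<pi> \<bullet> (x i + y i) = path_row Mf \<pi> \<bullet> x i + path_row Mf \<pi> \<bullet> y i"
      if "\<pi> \<in> Poly_Mapping.keys p" for \<pi>
      using that p path_row_carrier[of \<pi>] PiE_mem[OF x i] PiE_mem[OF y i]
      by (intro scalar_prod_add_distrib) (auto simp: paths_to_inf_eq)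
    then have "Poly_Mapping.lookup p \<pi> * (path_mat Q \<alpha> \<zeta> Mf \<pi> *\<^sub>v (x i + y i)) $ 0 =
        Poly_Mapping.lookup p \<pi> * (path_mat Q \<alpha> \<zeta> Mf \<pi> *\<^sub>v x i) $ 0 +
        Poly_Mapping.lookup p \<pi> * (path_mat Q \<alpha> \<zeta> Mf \<pi> *\<^sub>v y i) $ 0"
      if "\<pi> \<in> Poly_Mapping.keys p" for \<pi>
    proof -
      have "\<pi> \<in> inf_paths" using that p by (auto simp: paths_to_inf_eq)
      with \<open>\<And>\<pi>. \<pi> \<in> Poly_Mapping.keys p \<Longrightarrow> _\<close>[OF that] show ?thesis
        by (simp add: path_mat_mult distrib_left)
    qed
    then show ?thesis
      unfolding sum.distrib[symmetric] by (intro sum.cong refl)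
  qed
  show ?thesis
    using * by (auto simp: J_space_def Phi_def fun_eq_iff)
qed

lemma Phi_smult:
  assumes x: "x \<in> ext_carrier"
  shows "c \<odot>\<^bsub>J_space TYPE('k) Q \<zeta>\<^esub> Phi Q \<alpha> \<zeta> Mf x = Phi Q \<alpha> \<zeta> Mf (\<lambda>i\<in>ext_verts. c \<cdot>\<^sub>v x i)"
proof -
  have *: "(\<Sum>\<pi>\<in>Poly_Mapping.keys p. Poly_Mapping.lookup p \<pi> * (path_mat Q \<alpha> \<zeta> Mf \<pi> *\<^sub>v (c \<cdot>\<^sub>v x i)) $ 0) =
    c * (\<Sum>\<pi>\<in>Poly_Mapping.keys p. Poly_Mapping.lookup p \<pi> * (path_mat Q \<alpha> \<zeta> Mf \<pi> *\<^sub>v x i) $ 0)"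
    if i: "i \<in> ext_verts" and p: "Poly_Mapping.keys p \<subseteq> paths_to_inf Q \<zeta> i" for i p
  proof -
    have "path_row Mf \<pi> \<bullet> (c \<cdot>\<^sub>v x i) = c * (path_row Mf \<pi> \<bullet> x i)"
      if "\<pi> \<in> Poly_Mapping.keys p" for \<pi>
      using that p path_row_carrier[of \<pi>] PiE_mem[OF x i]
      by (intro scalar_prod_smult_distrib) (auto simp: paths_to_inf_eq)
    then show ?thesis
      using p by (auto simp: path_mat_mult paths_to_inf_eq subset_iff sum_distrib_left mult_ac intro!: sum.cong)
  qed
  show ?thesis
    using * by (auto simp: J_space_def Phi_def fun_eq_iff)
qed

lemma ext_carrier_add:
  "x \<in> ext_carrier \<Longrightarrow> y \<in> ext_carrier \<Longrightarrow> (\<lambda>i\<in>ext_verts. x i + y i) \<in> ext_carrier"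
  unfolding restrict_PiE_iff by (intro ballI add_carrier_vec) (erule (1) PiE_mem)+

lemma ext_carrier_smult: "x \<in> ext_carrier \<Longrightarrow> (\<lambda>i\<in>ext_verts. c \<cdot>\<^sub>v x i) \<in> ext_carrier"
  unfolding restrict_PiE_iff by (intro ballI smult_carrier_vec[THEN iffD2]) (erule (1) PiE_mem)

lemma closed_image: "closed_carrier image_space"
proof
  show "carrier image_space \<noteq> {}" by (auto simp: Phi_image_eq PiE_eq_empty_iff intro: zero_carrier_vec)
  show "x \<oplus>\<^bsub>image_space\<^esub> y \<in> carrier image_space"
    if "x \<in> carrier image_space" "y \<in> carrier image_space" for x y
    using that by (auto simp: Phi_image_eq Phi_add simp del: restrict_PiE_iff intro!: imageI ext_carrier_add)
  show "c \<odot>\<^bsub>image_space\<^esub> x \<in> carrier image_space" if "x \<in> carrier image_space" for c x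
    using that by (auto simp: Phi_image_eq Phi_smult simp del: restrict_PiE_iff intro!: imageI ext_carrier_smult)
qed

definition path_restr :: "('v, 'a) qpath \<Rightarrow> ('v ext_vertex \<Rightarrow> (('v, 'a) qpath \<Rightarrow>\<^sub>0 'k) \<Rightarrow> 'k) \<Rightarrow> 'k" where
  "path_restr \<pi> = restrict (path_fun \<pi>) (Phi_image Q \<alpha> \<zeta> Mf)"

lemma path_restr_Phi:
  "\<pi> \<in> inf_paths \<Longrightarrow> x \<in> ext_carrier \<Longrightarrow> path_restr \<pi> (Phi Q \<alpha> \<zeta> Mf x) = path_row Mf \<pi> \<bullet> x (fst \<pi>)"
  by (auto simp: path_restr_def path_fun_Phi Phi_image_eq)

lemma path_restr_dual:
  assumes "\<pi> \<in> inf_paths"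
  shows "path_restr \<pi> \<in> carrier (dual_vs image_space)"
proof -
  interpret closed_carrier image_space by (rule closed_image)
  show ?thesis
    using add_closed smult_closed assms inf_paths_tail[OF assms]
    by (auto simp: dual_vs_carrier path_restr_def path_fun_def J_space_ops inf_paths_iff)
qed

text \<open>Every point of the image is some \<open>Phi x\<close>, where a path takes the value of
  its row on the component of \<open>x\<close> at its tail. So relations between paths become
  relations between rows.\<close>

lemma restrictions_basis_iff:
  assumes "P \<subseteq> inf_paths"
  shows "restrictions_basis Q \<alpha> \<zeta> Mf P \<longleftrightarrow>
    (\<forall>A c. finite A \<longrightarrow> A \<subseteq> P \<longrightarrow>
       (\<forall>x\<in>ext_carrier. (\<Sum>\<pi>\<in>A. c \<pi> * (path_row Mf \<pi> \<bullet> x (fst \<pi>))) = 0) \<longrightarrow> (\<forall>\<pi>\<in>A. c \<pi> = 0)) \<and>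
    (\<forall>f\<in>carrier (dual_vs image_space). \<exists>A c. finite A \<and> A \<subseteq> P \<and>
       (\<forall>x\<in>ext_carrier. f (Phi Q \<alpha> \<zeta> Mf x) = (\<Sum>\<pi>\<in>A. c \<pi> * (path_row Mf \<pi> \<bullet> x (fst \<pi>)))))"
proof -
  interpret closed_carrier image_space by (rule closed_image)
  have sum: "(\<Sum>\<pi>\<in>A. c \<pi> * path_restr \<pi> (Phi Q \<alpha> \<zeta> Mf x)) = (\<Sum>\<pi>\<in>A. c \<pi> * (path_row Mf \<pi> \<bullet> x (fst \<pi>)))"
    if "A \<subseteq> P" "x \<in> ext_carrier" for A c x
    using that assms by (intro sum.cong refl) (auto simp: path_restr_Phi)
  have "restrictions_basis Q \<alpha> \<zeta> Mf P \<longleftrightarrow>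
      inj_on path_restr P \<and> vectorspace.basis class_ring (dual_vs image_space) (path_restr ` P)"
    by (simp add: restrictions_basis_def path_restr_def[abs_def] Let_def)
  also have "\<dots> \<longleftrightarrow>
    (\<forall>A c. finite A \<longrightarrow> A \<subseteq> P \<longrightarrow> (\<forall>x\<in>carrier image_space. (\<Sum>p\<in>A. c p * path_restr p x) = 0) \<longrightarrow> (\<forall>p\<in>A. c p = 0)) \<and>
    (\<forall>f\<in>carrier (dual_vs image_space). \<exists>A c. finite A \<and> A \<subseteq> P \<and> (\<forall>x\<in>carrier image_space. f x = (\<Sum>p\<in>A. c p * path_restr p x)))"
    using assms by (intro dual_basis_iff) (auto intro: path_restr_dual)
  finally show ?thesis
    by (simp add: Phi_image_eq sum cong: conj_cong imp_cong)
qed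

text \<open>The inclusion of the summand at \<open>i\<close> into the direct sum.\<close>

definition supported :: "'v ext_vertex \<Rightarrow> 'k vec \<Rightarrow> 'v ext_vertex \<Rightarrow> 'k vec" where
  "supported i y = (\<lambda>j\<in>ext_verts. if j = i then y else 0\<^sub>v (ext_dim \<alpha> j))"

lemma supported_carrier: "y \<in> carrier_vec (ext_dim \<alpha> i) \<Longrightarrow> supported i y \<in> ext_carrier"
  by (auto simp: supported_def)

lemma row_supported:
  assumes "\<pi> \<in> inf_paths" "i \<in> ext_verts" "y \<in> carrier_vec (ext_dim \<alpha> i)"
  shows "path_row Mf \<pi> \<bullet> supported i y (fst \<pi>) = (if fst \<pi> = i then path_row Mf \<pi> \<bullet> y else 0)"
  using assms inf_paths_tail[OF assms(1)] path_row_carrier[OF assms(1)] by (auto simp: supported_def)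

text \<open>The paths from different vertices see different summands of the direct sum, so a
  relation splits into one relation per vertex.\<close>

lemma indep_iff:
  assumes P: "P \<subseteq> inf_paths"
  shows "(\<forall>A c. finite A \<longrightarrow> A \<subseteq> P \<longrightarrow>
       (\<forall>x\<in>ext_carrier. (\<Sum>\<pi>\<in>A. c \<pi> * (path_row Mf \<pi> \<bullet> x (fst \<pi>))) = 0) \<longrightarrow> (\<forall>\<pi>\<in>A. c \<pi> = 0)) \<longleftrightarrow>
    (\<forall>i\<in>ext_verts. indep_fam (ext_dim \<alpha> i) (path_row Mf) (paths_from P i))" (is "?L \<longleftrightarrow> ?R")
proof
  assume L: ?L
  show ?R
    unfolding indep_fam_def
  proof (intro ballI allI impI)
    fix i A c \<pi>
    assume i: "i \<in> ext_verts" and A: "finite A" "A \<subseteq> paths_from P i"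
      "\<forall>j<ext_dim \<alpha> i. (\<Sum>\<pi>\<in>A. c \<pi> * path_row Mf \<pi> $ j) = 0" "\<pi> \<in> A"
    have "(\<Sum>\<pi>\<in>A. c \<pi> * (path_row Mf \<pi> \<bullet> x (fst \<pi>))) = 0" if x: "x \<in> ext_carrier" for x
    proof -
      have "(\<Sum>\<pi>\<in>A. c \<pi> * (path_row Mf \<pi> \<bullet> x (fst \<pi>))) =
          (\<Sum>\<pi>\<in>A. \<Sum>j<ext_dim \<alpha> i. c \<pi> * path_row Mf \<pi> $ j * x i $ j)"
        using A(2) PiE_mem[OF x i]
        by (intro sum.cong) (auto simp: scalar_prod_def sum_distrib_left mult.assoc atLeast0LessThan)
      also have "\<dots> = (\<Sum>j<ext_dim \<alpha> i. (\<Sum>\<pi>\<in>A. c \<pi> * path_row Mf \<pi> $ j) * x i $ j)"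
        by (subst sum.swap) (simp add: sum_distrib_right)
      also have "\<dots> = 0" using A(3) by simp
      finally show ?thesis .
    qed
    moreover have "A \<subseteq> P" using A(2) by auto
    ultimately show "c \<pi> = 0" using L[rule_format, of A c \<pi>] A(1,4) by blast
  qed
next
  assume R: ?R
  show ?L
  proof safe
    fix A c i p
    assume A: "finite A" "A \<subseteq> P"
      "\<forall>x\<in>ext_carrier. (\<Sum>\<pi>\<in>A. c \<pi> * (path_row Mf \<pi> \<bullet> x (fst \<pi>))) = 0" "(i, p) \<in> A"
    have i: "i \<in> ext_verts" using inf_paths_tail[of "(i, p)"] A P by auto
    have "(\<Sum>\<pi>\<in>paths_from A i. c \<pi> * path_row Mf \<pi> $ j) = 0" if j: "j < ext_dim \<alpha> i" for j
    proof -
      \<comment> \<open>The test point is a unit vector placed at the single vertex i: paths with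
        another tail drop out, and the others contribute their j-th coordinate.\<close>
      have "0 = (\<Sum>\<pi>\<in>A. c \<pi> * (path_row Mf \<pi> \<bullet> supported i (unit_vec (ext_dim \<alpha> i) j) (fst \<pi>)))"
        using A(3) supported_carrier[of "unit_vec (ext_dim \<alpha> i) j" i] by simp
      also have "\<dots> = (\<Sum>\<pi>\<in>A. if fst \<pi> = i then c \<pi> * path_row Mf \<pi> $ j else 0)"
        using A(2) P i j path_row_carrier
        by (intro sum.cong refl) (subst row_supported; fastforce)
      also have "\<dots> = (\<Sum>\<pi>\<in>paths_from A i. c \<pi> * path_row Mf \<pi> $ j)"
        using A(1) by (simp add: sum.inter_filter)
      finally show ?thesis by simp
    qed
    then show "c (i, p) = 0"
      using R i A(1,2,4) indep_famD[of "ext_dim \<alpha> i" "path_row Mf" "paths_from P i" "paths_from A i" c "(i, p)"]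
      by fastforce
  qed
qed

text \<open>Spanning is proved with dual vectors \<open>z \<pi>\<close> in the direct sum: a
  functional f on the image equals the combination of the paths \<pi> with coefficients
  f(\<Phi>(\<open>z \<pi>\<close>)), because x and the corresponding combination of the
  \<open>z \<pi>\<close> have the same value under every row in \<open>P\<close>.\<close>

lemma restrictions_basisI:
  assumes P: "P \<subseteq> inf_paths"
    and ind: "\<And>i. i \<in> ext_verts \<Longrightarrow> indep_fam (ext_dim \<alpha> i) (path_row Mf) (paths_from P i)"
    and sep: "\<And>i. i \<in> ext_verts \<Longrightarrow> sep_fam (ext_dim \<alpha> i) (path_row Mf) (paths_from P i)"
  shows "restrictions_basis Q \<alpha> \<zeta> Mf P"
proof -
  interpret closed_carrier image_space by (rule closed_image)
  have rowc: "path_row Mf \<pi> \<in> carrier_vec (ext_dim \<alpha> i)" if "\<pi> \<in> paths_from P i" for \<pi> i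
    using that P path_row_carrier[of \<pi>] by auto
  \<comment> \<open>Independence makes each fibre over a vertex finite, and there are finitely many
    vertices; so one finite sum over \<open>P\<close> can serve all vertices at once.\<close>
  have "finite (paths_from P i)" if "i \<in> ext_verts" for i
    using indep_fam_card_le(1)[OF ind[OF that] rowc] by blast
  moreover have "P = (\<Union>i\<in>ext_verts. paths_from P i)" using P inf_paths_tail by auto
  ultimately have finP: "finite P" using finite_UN[of ext_verts] finite_verts
    by (metis (no_types, lifting) finite.insertI finite_imageI)
  have "\<exists>y. \<forall>i\<in>ext_verts. (\<forall>\<pi>\<in>paths_from P i. y i \<pi> \<in> carrier_vec (ext_dim \<alpha> i)) \<and>
      (\<forall>\<pi>\<in>paths_from P i. \<forall>\<tau>\<in>paths_from P i. path_row Mf \<pi> \<bullet> y i \<tau> = (if \<pi> = \<tau> then 1 else 0))"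
  proof (intro bchoice ballI)
    fix i assume "i \<in> ext_verts"
    then obtain y where "\<And>\<pi>. \<pi> \<in> paths_from P i \<Longrightarrow> y \<pi> \<in> carrier_vec (ext_dim \<alpha> i)"
      "\<And>\<pi> \<tau>. \<pi> \<in> paths_from P i \<Longrightarrow> \<tau> \<in> paths_from P i \<Longrightarrow>
        path_row Mf \<pi> \<bullet> y \<tau> = (if \<pi> = \<tau> then 1 else 0)"
      using dual_family[OF ind sep rowc] by blast
    then show "\<exists>y. (\<forall>\<pi>\<in>paths_from P i. y \<pi> \<in> carrier_vec (ext_dim \<alpha> i)) \<and>
      (\<forall>\<pi>\<in>paths_from P i. \<forall>\<tau>\<in>paths_from P i. path_row Mf \<pi> \<bullet> y \<tau> = (if \<pi> = \<tau> then 1 else 0))"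
      by (intro exI[of _ y]) blast
  qed
  then obtain y where Y: "\<forall>i\<in>ext_verts. (\<forall>\<pi>\<in>paths_from P i. y i \<pi> \<in> carrier_vec (ext_dim \<alpha> i)) \<and>
      (\<forall>\<pi>\<in>paths_from P i. \<forall>\<tau>\<in>paths_from P i. path_row Mf \<pi> \<bullet> y i \<tau> = (if \<pi> = \<tau> then 1 else 0))"
    by (rule exE)
  have yc: "\<And>i \<pi>. i \<in> ext_verts \<Longrightarrow> \<pi> \<in> paths_from P i \<Longrightarrow> y i \<pi> \<in> carrier_vec (ext_dim \<alpha> i)"
    and y: "\<And>i \<pi> \<tau>. i \<in> ext_verts \<Longrightarrow> \<pi> \<in> paths_from P i \<Longrightarrow> \<tau> \<in> paths_from P i \<Longrightarrow>
      path_row Mf \<pi> \<bullet> y i \<tau> = (if \<pi> = \<tau> then 1 else 0)"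
    using Y by blast+
  \<comment> \<open>Extension by zero turns the dual bases at the single vertices into one dual
    system for all of \<open>P\<close>.\<close>
  define z where "z \<pi> = supported (fst \<pi>) (y (fst \<pi>) \<pi>)" for \<pi>
  have zc: "z \<pi> \<in> ext_carrier" if "\<pi> \<in> P" for \<pi>
    unfolding z_def using that inf_paths_tail[OF subsetD[OF P that]] yc[of "fst \<pi>" \<pi>]
    by (intro supported_carrier) auto
  have z: "path_row Mf \<tau> \<bullet> z \<pi> (fst \<tau>) = (if \<pi> = \<tau> then 1 else 0)" if "\<pi> \<in> P" "\<tau> \<in> P" for \<pi> \<tau>
  proof -
    have "fst \<pi> \<in> ext_verts" "y (fst \<pi>) \<pi> \<in> carrier_vec (ext_dim \<alpha> (fst \<pi>))"
      using that inf_paths_tail[OF subsetD[OF P that(1)]] yc[of "fst \<pi>" \<pi>] by auto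
    then have "path_row Mf \<tau> \<bullet> z \<pi> (fst \<tau>) =
        (if fst \<tau> = fst \<pi> then path_row Mf \<tau> \<bullet> y (fst \<pi>) \<pi> else 0)"
      unfolding z_def using that P by (intro row_supported) auto
    then show ?thesis
    proof (cases "fst \<tau> = fst \<pi>")
      case True
      then have "path_row Mf \<tau> \<bullet> y (fst \<pi>) \<pi> = (if \<tau> = \<pi> then 1 else 0)"
        using that by (intro y[OF \<open>fst \<pi> \<in> ext_verts\<close>]) auto
      with True \<open>path_row Mf \<tau> \<bullet> z \<pi> (fst \<tau>) = _\<close> show ?thesis by simp
    qed auto
  qed
  have "\<exists>A c. finite A \<and> A \<subseteq> P \<and>
       (\<forall>x\<in>ext_carrier. f (Phi Q \<alpha> \<zeta> Mf x) = (\<Sum>\<pi>\<in>A. c \<pi> * (path_row Mf \<pi> \<bullet> x (fst \<pi>))))"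
    if f: "f \<in> carrier (dual_vs image_space)" for f
  proof (intro exI conjI ballI)
    fix x assume x: "x \<in> ext_carrier"
    \<comment> \<open>\<open>w\<close> is the combination of the points
      \<Phi>(\<open>z \<pi>\<close>) weighted by the values of the rows on \<open>x\<close>, known
      through functionals only. Its preimage \<open>x'\<close> will turn out to be
      \<open>x\<close>.\<close>
    obtain w where w: "w \<in> carrier image_space" "\<And>f. f \<in> carrier (dual_vs image_space) \<Longrightarrow>
        f w = (\<Sum>\<pi>\<in>P. (path_row Mf \<pi> \<bullet> x (fst \<pi>)) * f (Phi Q \<alpha> \<zeta> Mf (z \<pi>)))"
      by (rule dual_combination[of P "\<lambda>\<pi>. Phi Q \<alpha> \<zeta> Mf (z \<pi>)" "\<lambda>\<pi>. path_row Mf \<pi> \<bullet> x (fst \<pi>)"])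
        (use finP zc in \<open>auto simp: Phi_image_eq\<close>)
    then obtain x' where x': "x' \<in> ext_carrier" "w = Phi Q \<alpha> \<zeta> Mf x'" by (auto simp: Phi_image_eq)
    have row_eq: "path_row Mf \<tau> \<bullet> x' (fst \<tau>) = path_row Mf \<tau> \<bullet> x (fst \<tau>)" if "\<tau> \<in> P" for \<tau>
    proof -
      have "path_row Mf \<tau> \<bullet> x' (fst \<tau>) = path_restr \<tau> w"
        using x' subsetD[OF P that] by (simp add: path_restr_Phi)
      also have "\<dots> = (\<Sum>\<pi>\<in>P. (path_row Mf \<pi> \<bullet> x (fst \<pi>)) * path_restr \<tau> (Phi Q \<alpha> \<zeta> Mf (z \<pi>)))"
        using that P by (intro w(2) path_restr_dual) auto
      also have "\<dots> = (\<Sum>\<pi>\<in>P. if \<pi> = \<tau> then path_row Mf \<pi> \<bullet> x (fst \<pi>) else 0)"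
        using that zc path_restr_Phi[OF subsetD[OF P that]] z
        by (intro sum.cong refl) auto
      also have "\<dots> = path_row Mf \<tau> \<bullet> x (fst \<tau>)" using finP that by simp
      finally show ?thesis .
    qed
    \<comment> \<open>All rows from \<open>P\<close> agree on \<open>x'\<close> and
      \<open>x\<close>, so separation at each vertex identifies them.\<close>
    have "x' = x"
    proof (rule PiE_ext[OF x'(1) x])
      fix i assume i: "i \<in> ext_verts"
      have c: "x' i \<in> carrier_vec (ext_dim \<alpha> i)" "x i \<in> carrier_vec (ext_dim \<alpha> i)"
        using PiE_mem[OF x'(1) i] PiE_mem[OF x i] by auto
      have "x' i - x i = 0\<^sub>v (ext_dim \<alpha> i)"
      proof (rule sep_famD[OF sep[OF i]])
        fix \<pi> assume \<pi>: "\<pi> \<in> paths_from P i"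
        show "path_row Mf \<pi> \<bullet> (x' i - x i) = 0"
          using row_eq[of \<pi>] \<pi> rowc[OF \<pi>] c by (simp add: scalar_prod_minus_distrib[of _ "ext_dim \<alpha> i"])
      qed (use c in auto)
      then have "x' i $ j - x i $ j = 0" if "j < ext_dim \<alpha> i" for j
        using c that by (metis carrier_vecD index_minus_vec(1) index_zero_vec(1))
      then show "x' i = x i" using c by (intro eq_vecI) auto
    qed
    then show "f (Phi Q \<alpha> \<zeta> Mf x) = (\<Sum>\<pi>\<in>P. f (Phi Q \<alpha> \<zeta> Mf (z \<pi>)) * (path_row Mf \<pi> \<bullet> x (fst \<pi>)))"
      using w(2)[OF f] x' by (simp add: mult.commute)
  qed (use finP in auto)
  then show ?thesis
    unfolding restrictions_basis_iff[OF P] indep_iff[OF P] using ind by blast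
qed

text \<open>Every path \<tau> to \<infinity> is a functional on the image, hence a combination of
  paths in \<open>P\<close>. A vector at \<open>i\<close> annihilated by the rows of
  \<open>P\<close> is therefore annihilated by the rows of all paths from \<open>i\<close>, and
  \<open>all\<close> finishes.\<close>

lemma restrictions_basisD:
  assumes P: "P \<subseteq> inf_paths" and B: "restrictions_basis Q \<alpha> \<zeta> Mf P" and i: "i \<in> ext_verts"
    and all: "sep_fam (ext_dim \<alpha> i) (path_row Mf) (paths_to_inf Q \<zeta> i)"
  shows "indep_fam (ext_dim \<alpha> i) (path_row Mf) (paths_from P i)"
    "sep_fam (ext_dim \<alpha> i) (path_row Mf) (paths_from P i)"
proof -
  show "indep_fam (ext_dim \<alpha> i) (path_row Mf) (paths_from P i)"
    using B i unfolding restrictions_basis_iff[OF P] indep_iff[OF P] by blast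
  have span: "\<forall>f\<in>carrier (dual_vs image_space). \<exists>A c. finite A \<and> A \<subseteq> P \<and>
       (\<forall>x\<in>ext_carrier. f (Phi Q \<alpha> \<zeta> Mf x) = (\<Sum>\<pi>\<in>A. c \<pi> * (path_row Mf \<pi> \<bullet> x (fst \<pi>))))"
    using B unfolding restrictions_basis_iff[OF P] by (rule conjunct2)
  show "sep_fam (ext_dim \<alpha> i) (path_row Mf) (paths_from P i)"
    unfolding sep_fam_def
  proof safe
    fix y assume y: "y \<in> carrier_vec (ext_dim \<alpha> i)" "\<forall>\<pi>\<in>paths_from P i. path_row Mf \<pi> \<bullet> y = 0"
    note s = supported_carrier[OF y(1)]
    show "y = 0\<^sub>v (ext_dim \<alpha> i)"
    proof (rule sep_famD[OF all y(1)])
      fix \<tau> assume "\<tau> \<in> paths_to_inf Q \<zeta> i"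
      then have \<tau>: "\<tau> \<in> inf_paths" "fst \<tau> = i" by (auto simp: paths_to_inf_eq)
      obtain A c where A: "finite A" "A \<subseteq> P"
        "\<forall>x\<in>ext_carrier. path_restr \<tau> (Phi Q \<alpha> \<zeta> Mf x) = (\<Sum>\<pi>\<in>A. c \<pi> * (path_row Mf \<pi> \<bullet> x (fst \<pi>)))"
        using span[rule_format, OF path_restr_dual[OF \<tau>(1)]] by blast
      have "path_row Mf \<tau> \<bullet> y = path_restr \<tau> (Phi Q \<alpha> \<zeta> Mf (supported i y))"
        unfolding path_restr_Phi[OF \<tau>(1) s] row_supported[OF \<tau>(1) i y(1)] using \<tau>(2) by simp
      also have "\<dots> = (\<Sum>\<pi>\<in>A. c \<pi> * (path_row Mf \<pi> \<bullet> supported i y (fst \<pi>)))" using A(3) s by blast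
      also have "\<dots> = 0"
      proof (intro sum.neutral ballI)
        fix \<pi> assume "\<pi> \<in> A"
        then have "\<pi> \<in> P" "\<pi> \<in> inf_paths" using A(2) P by auto
        then show "c \<pi> * (path_row Mf \<pi> \<bullet> supported i y (fst \<pi>)) = 0"
          using row_supported[OF _ i y(1), of \<pi>] bspec[OF y(2), of \<pi>] by auto
      qed
      finally show "path_row Mf \<tau> \<bullet> y = 0" .
    qed
  qed
qed

end

end

section \<open>Skeleta of stable pairs\<close>

lemma subspace_vecI:
  assumes "N \<subseteq> carrier_vec n" "0\<^sub>v n \<in> N" "\<And>x y. x \<in> N \<Longrightarrow> y \<in> N \<Longrightarrow> x + y \<in> N"
    "\<And>c x. x \<in> N \<Longrightarrow> c \<cdot>\<^sub>v x \<in> N"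
  shows "VectorSpace.subspace class_ring N (module_vec TYPE('k :: field) n)"
  using assms
  by (intro VectorSpace.subspace.intro vec_vs submodule.intro vec_module) (auto simp: module_vec_simps)

lemma subspace_vecD:
  assumes "VectorSpace.subspace class_ring N (module_vec TYPE('k :: field) n)"
  shows "N \<subseteq> carrier_vec n" "0\<^sub>v n \<in> N" "x \<in> N \<Longrightarrow> y \<in> N \<Longrightarrow> x + y \<in> N"
    "x \<in> N \<Longrightarrow> c \<cdot>\<^sub>v x \<in> N"
  using VectorSpace.subspace.submod[OF assms]
  by (auto simp: submodule_def module_vec_simps class_ring_simps)

context framed_quiver
begin

definition suffix_closed :: "('v, 'a) qpath set \<Rightarrow> bool" where
  "suffix_closed S \<longleftrightarrow>
     (\<forall>i b p. (i, b # p) \<in> S \<and> p \<noteq> [] \<longrightarrow> (head (ext_quiver Q \<zeta>) b, p) \<in> S)"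

text \<open>A partial skeleton: everything that a J-skeleton needs except that its rows separate
  points. These are the sets that get enlarged to skeleta.\<close>

definition indep_paths :: "('v, 'a, 'k :: field) framed \<Rightarrow> ('v, 'a) qpath set \<Rightarrow> bool" where
  "indep_paths Mf S \<longleftrightarrow> S \<subseteq> inf_paths - {inf_path} \<and> suffix_closed S \<and>
     (\<forall>i\<in>verts Q. indep_fam (\<alpha> i) (path_row Mf) (paths_at S i))"

lemma stable_reps_framed: "Mf \<in> stable_reps Q \<alpha> \<zeta> \<Longrightarrow> Mf \<in> framed_reps Q \<alpha> \<zeta>"
  by (simp add: stable_reps_def)

text \<open>The common kernel of the rows is a subrepresentation inside \<open>ker f\<close>.\<close>

lemma stable_sep_fam:
  fixes Mf :: "('v, 'a, 'k :: field) framed"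
  assumes Mf: "Mf \<in> stable_reps Q \<alpha> \<zeta>" and S: "S \<subseteq> inf_paths"
    and frame: "\<And>i q y. i \<in> verts Q \<Longrightarrow> q < \<zeta> i \<Longrightarrow> y \<in> carrier_vec (\<alpha> i) \<Longrightarrow>
      (\<And>\<pi>. \<pi> \<in> paths_at S i \<Longrightarrow> path_row Mf \<pi> \<bullet> y = 0) \<Longrightarrow> path_row Mf (Vertex i, [Frame i q]) \<bullet> y = 0"
    and arrow: "\<And>a p y. a \<in> arcs Q \<Longrightarrow> (Vertex (head Q a), p) \<in> S \<Longrightarrow> y \<in> carrier_vec (\<alpha> (tail Q a)) \<Longrightarrow>
      (\<And>\<pi>. \<pi> \<in> paths_at S (tail Q a) \<Longrightarrow> path_row Mf \<pi> \<bullet> y = 0) \<Longrightarrow>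
      path_row Mf (Vertex (tail Q a), Arrow a # p) \<bullet> y = 0"
    and i: "i \<in> verts Q"
  shows "sep_fam (\<alpha> i) (path_row Mf) (paths_at S i)"
proof -
  note fr = stable_reps_framed[OF Mf]
  note M = framed_carrier[OF fr]
  define N where "N i = {y \<in> carrier_vec (\<alpha> i). \<forall>\<pi>\<in>paths_at S i. path_row Mf \<pi> \<bullet> y = 0}" for i
  have row: "path_row Mf \<pi> \<in> carrier_vec (\<alpha> i)" if "\<pi> \<in> paths_at S i" for \<pi> i
    using that S path_row_carrier[OF fr, of \<pi>] by (auto simp: paths_at_def)
  have "subrep Q \<alpha> (fst Mf) N"
    unfolding subrep_def
  proof (intro conjI ballI)
    fix i assume "i \<in> verts Q"
    show "VectorSpace.subspace class_ring (N i) (module_vec TYPE('k) (\<alpha> i))"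
      by (rule subspace_vecI) (use row in \<open>auto simp: N_def scalar_prod_add_distrib[of _ "\<alpha> i"]\<close>)
  next
    fix a y assume a: "a \<in> arcs Q" and y: "y \<in> N (tail Q a)"
    \<comment> \<open>The row of \<pi> kills \<open>M_a y\<close> iff the row of the longer path
      \<pi>a kills \<open>y\<close>, which is what \<open>arrow\<close> provides.\<close>
    have "path_row Mf \<pi> \<bullet> (fst Mf a *\<^sub>v y) = 0" if "\<pi> \<in> paths_at S (head Q a)" for \<pi>
    proof -
      define p where "p = snd \<pi>"
      have p: "\<pi> = (Vertex (head Q a), p)" "(Vertex (head Q a), p) \<in> S"
        using that by (auto simp: paths_at_def p_def prod_eq_iff) (metis prod.collapse)
      have "path_row Mf (Vertex (tail Q a), Arrow a # p) \<bullet> y = 0"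
        using y by (intro arrow[OF a p(2)]) (auto simp: N_def)
      then show ?thesis
        using path_row_arrow[OF fr a subsetD[OF S p(2)], of y] y p(1) by (simp add: N_def)
    qed
    then show "fst Mf a *\<^sub>v y \<in> N (head Q a)"
      using M(1)[OF a] y by (auto simp: N_def)
  qed
  moreover have "N i \<subseteq> mat_kernel (snd Mf i)" if "i \<in> verts Q" for i
  proof
    fix y assume y: "y \<in> N i"
    have "snd Mf i *\<^sub>v y = 0\<^sub>v (\<zeta> i)"
    proof (rule eq_vecI)
      fix q assume "q < dim_vec (0\<^sub>v (\<zeta> i) :: 'k vec)"
      then have q: "q < \<zeta> i" by simp
      have "path_row Mf (Vertex i, [Frame i q]) \<bullet> y = 0"
        using y by (intro frame[OF that q]) (auto simp: N_def)
      then show "(snd Mf i *\<^sub>v y) $ q = 0\<^sub>v (\<zeta> i) $ q"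
        using path_row_frame[OF fr that q] M(2)[OF that] q by simp
    qed (use M(2)[OF that] in auto)
    then show "y \<in> mat_kernel (snd Mf i)"
      using mat_kernel[OF M(2)[OF that]] y by (auto simp: N_def)
  qed
  ultimately have "N i = {0\<^sub>v (\<alpha> i)}"
    using Mf i unfolding stable_reps_def stable_def case_prod_unfold by blast
  then show ?thesis by (auto simp: sep_fam_def N_def)
qed

text \<open>The component at \<infinity> is one-dimensional and the row of
  \<open>e_\<infinity>\<close> is its identity, so the extra vertex imposes no condition on a
  skeleton.\<close>

lemma indep_sep_inf:
  assumes "Mf \<in> framed_reps Q \<alpha> \<zeta>"
  shows "indep_fam (Suc 0) (path_row Mf) {inf_path}" "sep_fam (Suc 0) (path_row Mf) {inf_path}"
proof -
  have row: "path_row Mf inf_path = unit_vec (Suc 0) 0" using path_row_inf[OF assms] by simp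
  show "indep_fam (Suc 0) (path_row Mf) {inf_path}"
    by (auto simp: indep_fam_def row subset_singleton_iff)
  show "sep_fam (Suc 0) (path_row Mf) {inf_path}"
    unfolding sep_fam_def by (auto simp: row intro!: eq_vecI)
qed

text \<open>This removes J~ from the rest of the proof. Stability enters through the separation of
  points by all paths together, which is needed to pass from a basis of the dual of the image to
  separation by \<SS>.\<close>

lemma J_skeleta_iff:
  assumes Mf: "Mf \<in> stable_reps Q \<alpha> \<zeta>"
  shows "S \<in> J_skeleta Q \<alpha> \<zeta> Mf \<longleftrightarrow>
    indep_paths Mf S \<and> (\<forall>i\<in>verts Q. sep_fam (\<alpha> i) (path_row Mf) (paths_at S i))"
proof -
  note fr = stable_reps_framed[OF Mf]
  have sub: "{\<pi> \<in> \<Union>i. paths_to_inf Q \<zeta> i. snd \<pi> \<noteq> []} = inf_paths - {inf_path}"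
    using inf_paths_nonempty by (auto simp: inf_paths_def)
  have at: "paths_from (insert inf_path S) (Vertex i) = paths_at S i" for i
    by (auto simp: paths_at_def inf_path_def)
  have inf: "paths_from (insert inf_path S) Infinity = {inf_path}" if "S \<subseteq> inf_paths - {inf_path}"
    using that inf_paths_Infinity by (auto simp: inf_path_def)
  \<comment> \<open>The set of all paths to \<infinity> contains every frame arrow and is closed
    under composition with arrows of the quiver, so at the vertices of the quiver the closure
    hypotheses of \<open>stable_sep_fam\<close> hold trivially.\<close>
  have all: "sep_fam (ext_dim \<alpha> i) (path_row Mf) (paths_to_inf Q \<zeta> i)" if "i \<in> ext_verts" for i
  proof (cases i)
    case (Vertex j)
    then have "sep_fam (\<alpha> j) (path_row Mf) (paths_at inf_paths j)"
      using that by (intro stable_sep_fam[OF Mf]) (auto simp: paths_at_def)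
    then show ?thesis using Vertex by (simp add: paths_to_inf_eq paths_at_def)
  next
    case Infinity
    then have "paths_to_inf Q \<zeta> i = {inf_path}"
      using inf_paths_Infinity by (auto simp: paths_to_inf_eq inf_path_def)
    then show ?thesis using Infinity indep_sep_inf(2)[OF fr] by simp
  qed
  have "restrictions_basis Q \<alpha> \<zeta> Mf (insert inf_path S) \<longleftrightarrow>
      (\<forall>i\<in>verts Q. indep_fam (\<alpha> i) (path_row Mf) (paths_at S i) \<and> sep_fam (\<alpha> i) (path_row Mf) (paths_at S i))"
    (is "?B \<longleftrightarrow> ?R") if S: "S \<subseteq> inf_paths - {inf_path}"
  proof
    assume ?B
    show ?R
    proof
      fix i assume "i \<in> verts Q"
      then have i: "Vertex i \<in> ext_verts" by simp
      show "indep_fam (\<alpha> i) (path_row Mf) (paths_at S i) \<and> sep_fam (\<alpha> i) (path_row Mf) (paths_at S i)"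
        using restrictions_basisD[OF fr _ \<open>?B\<close> i all[OF i]] S unfolding at by auto
    qed
  next
    assume R: ?R
    show ?B
    proof (rule restrictions_basisI[OF fr])
      fix i assume "i \<in> ext_verts"
      then show "indep_fam (ext_dim \<alpha> i) (path_row Mf) (paths_from (insert inf_path S) i)"
        "sep_fam (ext_dim \<alpha> i) (path_row Mf) (paths_from (insert inf_path S) i)"
        using R indep_sep_inf[OF fr] inf[OF S] at by auto
    qed (use S in auto)
  qed
  then show ?thesis
    unfolding J_skeleta_def mem_Collect_eq sub indep_paths_def suffix_closed_def by blast
qed

section \<open>Finiteness of skeleta and of \<Gamma>(\<alpha>)\<close>

lemma indep_paths_bound:
  assumes fr: "Mf \<in> framed_reps Q \<alpha> \<zeta>" and S: "indep_paths Mf S"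
  shows "finite S" "card S \<le> sum \<alpha> (verts Q)"
proof -
  have SU: "S = (\<Union>i\<in>verts Q. paths_at S i)"
  proof
    show "S \<subseteq> (\<Union>i\<in>verts Q. paths_at S i)"
    proof
      fix \<pi> assume \<pi>: "\<pi> \<in> S"
      then have "\<pi> \<in> inf_paths" "\<pi> \<noteq> inf_path" using S by (auto simp: indep_paths_def)
      then have "fst \<pi> \<in> Vertex ` verts Q" using inf_paths_tail inf_paths_Infinity by blast
      then show "\<pi> \<in> (\<Union>i\<in>verts Q. paths_at S i)" using \<pi> by (auto simp: paths_at_def)
    qed
  qed (auto simp: paths_at_def)
  have *: "finite (paths_at S i)" "card (paths_at S i) \<le> \<alpha> i" if "i \<in> verts Q" for i
  proof -
    have "path_row Mf \<pi> \<in> carrier_vec (\<alpha> i)" if "\<pi> \<in> paths_at S i" for \<pi>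
      using that S path_row_carrier[OF fr, of \<pi>] by (auto simp: paths_at_def indep_paths_def)
    then show "finite (paths_at S i)" "card (paths_at S i) \<le> \<alpha> i"
      using indep_fam_card_le[of "\<alpha> i" "path_row Mf" "paths_at S i"] S that
      by (auto simp: indep_paths_def)
  qed
  show "finite S" using *(1) finite_verts by (subst SU) auto
  have "card S \<le> (\<Sum>i\<in>verts Q. card (paths_at S i))"
    by (subst SU) (rule card_UN_le, rule finite_verts)
  also have "\<dots> \<le> sum \<alpha> (verts Q)" using *(2) by (rule sum_mono)
  finally show "card S \<le> sum \<alpha> (verts Q)" .
qed

lemma suffix_closed_length:
  assumes "suffix_closed S" "(i, p) \<in> S" "m < length p"
  shows "\<exists>j q. (j, q) \<in> S \<and> length q = Suc m"
  using assms(2,3)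
proof (induction p arbitrary: i)
  case (Cons b p)
  show ?case
  proof (cases "m = length p")
    case True
    then show ?thesis using Cons.prems by (intro exI[of _ i] exI[of _ "b # p"]) simp
  next
    case False
    then have "m < length p" using Cons.prems by simp
    moreover from this have "(head (ext_quiver Q \<zeta>) b, p) \<in> S"
      using assms(1) Cons.prems unfolding suffix_closed_def by force
    ultimately show ?thesis using Cons.IH by blast
  qed
qed simp

text \<open>The nonempty suffixes of \<open>p\<close> have the lengths 1, ...,
  \<open>length p\<close> and all occur in \<open>S\<close>; paths of different lengths are
  different elements.\<close>

lemma suffix_closed_length_le:
  assumes "suffix_closed S" "finite S" "(i, p) \<in> S"
  shows "length p \<le> card S"
proof -
  have "Suc ` {..<length p} \<subseteq> (length \<circ> snd) ` S"
    using suffix_closed_length[OF assms(1,3)] by (force simp: image_iff)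
  then have "card (Suc ` {..<length p}) \<le> card S"
    using surj_card_le[OF assms(2)] by blast
  then show ?thesis by (simp add: card_image)
qed

text \<open>The length bound involves \<alpha> but no pair, so this one finite set contains the
  skeleta of all stable pairs simultaneously. That makes \<Gamma>(\<alpha>) finite over every
  field.\<close>

definition bounded_paths :: "('v, 'a) qpath set" where
  "bounded_paths = ext_verts \<times>
     {p. set p \<subseteq> arcs (ext_quiver Q \<zeta>) \<and> length p \<le> sum \<alpha> (verts Q)}"

lemma finite_bounded_paths: "finite bounded_paths"
  unfolding bounded_paths_def using finite_ext_arcs finite_verts
  by (intro finite_cartesian_product finite_lists_length_le) auto

lemma J_skeleton_bounded:
  assumes Mf: "Mf \<in> stable_reps Q \<alpha> \<zeta>" and S: "S \<in> J_skeleta Q \<alpha> \<zeta> Mf"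
  shows "S \<subseteq> bounded_paths"
proof
  fix \<pi> assume \<pi>: "\<pi> \<in> S"
  have ind: "indep_paths Mf S" using J_skeleta_iff[OF Mf] S by blast
  note b = indep_paths_bound[OF stable_reps_framed[OF Mf] ind]
  have "\<pi> \<in> inf_paths" "suffix_closed S" using ind \<pi> by (auto simp: indep_paths_def)
  moreover have "length (snd \<pi>) \<le> sum \<alpha> (verts Q)"
    using suffix_closed_length_le[OF \<open>suffix_closed S\<close> b(1), of "fst \<pi>" "snd \<pi>"] \<pi> b(2) by simp
  ultimately show "\<pi> \<in> bounded_paths"
    using inf_paths_tail inf_paths_arcs
    by (cases \<pi>) (force simp: bounded_paths_def simp del: ext_quiver_simps)
qed

lemma finite_J_skeleta:
  assumes "Mf \<in> stable_reps Q \<alpha> \<zeta>"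
  shows "finite (J_skeleta Q \<alpha> \<zeta> Mf)"
proof (rule finite_subset)
  show "J_skeleta Q \<alpha> \<zeta> Mf \<subseteq> Pow bounded_paths" using J_skeleton_bounded[OF assms] by blast
qed (simp add: finite_bounded_paths)

lemma finite_Gamma: "finite (Gamma TYPE('k :: field) Q \<alpha> \<zeta>)"
proof (rule finite_subset[OF _ finite_bounded_paths])
  show "Gamma TYPE('k) Q \<alpha> \<zeta> \<subseteq> bounded_paths"
    unfolding Gamma_def J_skeleta_of_dim_def by (intro Union_least) (blast dest: J_skeleton_bounded)
qed

lemma finite_Gamma_tilde: "finite (Gamma_tilde TYPE('k :: field) Q \<alpha> \<zeta>)"
proof -
  have "{(Vertex (tail Q a), Arrow a # p) | a p.
        a \<in> arcs Q \<and> (Vertex (head Q a), p) \<in> Gamma TYPE('k) Q \<alpha> \<zeta>} \<subseteq>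
      (\<lambda>(a, \<tau>). (Vertex (tail Q a), Arrow a # snd \<tau>)) ` (arcs Q \<times> Gamma TYPE('k) Q \<alpha> \<zeta>)"
    by force
  then show ?thesis
    unfolding Gamma_tilde_def using finite_Gamma finite_arcs
    by (metis (no_types, lifting) finite_SigmaI finite_Un finite_imageI finite_subset)
qed

section \<open>Enlarging independent sets of paths to skeleta\<close>

lemma indep_paths_insert:
  assumes fr: "Mf \<in> framed_reps Q \<alpha> \<zeta>" and S: "indep_paths Mf S"
    and \<pi>: "\<pi> \<in> inf_paths" "fst \<pi> = Vertex i"
    and suffix: "\<And>b p. snd \<pi> = b # p \<Longrightarrow> p \<noteq> [] \<Longrightarrow> (head (ext_quiver Q \<zeta>) b, p) \<in> S"
    and y: "y \<in> carrier_vec (\<alpha> i)" "\<And>\<tau>. \<tau> \<in> paths_at S i \<Longrightarrow> path_row Mf \<tau> \<bullet> y = 0" "path_row Mf \<pi> \<bullet> y \<noteq> 0"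
  shows "indep_paths Mf (insert \<pi> S)" "\<pi> \<notin> S"
proof -
  show "\<pi> \<notin> S"
  proof
    assume "\<pi> \<in> S"
    then have "\<pi> \<in> paths_at S i" using \<pi> by (simp add: paths_at_def)
    then show False using y by blast
  qed
  have "suffix_closed (insert \<pi> S)"
    using S suffix unfolding suffix_closed_def indep_paths_def by fastforce
  moreover have "indep_fam (\<alpha> j) (path_row Mf) (paths_at (insert \<pi> S) j)" if j: "j \<in> verts Q" for j
  proof (cases "j = i")
    case True
    then have eq: "paths_at (insert \<pi> S) j = insert \<pi> (paths_at S j)" using \<pi> by (auto simp: paths_at_def)
    have "path_row Mf \<tau> \<in> carrier_vec (\<alpha> j)" if "\<tau> \<in> paths_at S j" for \<tau>
      using that S path_row_carrier[OF fr, of \<tau>] by (auto simp: paths_at_def indep_paths_def)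
    then show ?thesis
      unfolding eq using True y \<pi> path_row_carrier[OF fr \<pi>(1)] \<open>\<pi> \<notin> S\<close> S j indep_paths_bound(1)[OF fr S]
      by (intro indep_fam_insert[of _ _ _ _ y]) (auto simp: paths_at_def indep_paths_def)
  next
    case False
    then have "paths_at (insert \<pi> S) j = paths_at S j" using \<pi> by (auto simp: paths_at_def)
    then show ?thesis using S j by (simp add: indep_paths_def)
  qed
  ultimately show "indep_paths Mf (insert \<pi> S)"
    using S \<pi> by (auto simp: indep_paths_def inf_path_def)
qed

text \<open>The prescribed part \<open>S0\<close> yields more than existence: a chosen path can be
  forced into a skeleton. This is used for frame arrows.\<close>

lemma extend_to_J_skeleton:
  assumes Mf: "Mf \<in> stable_reps Q \<alpha> \<zeta>" and S0: "indep_paths Mf S0"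
  obtains S where "S \<in> J_skeleta Q \<alpha> \<zeta> Mf" "S0 \<subseteq> S"
proof -
  note fr = stable_reps_framed[OF Mf]
  \<comment> \<open>Maximality is taken with respect to cardinality, which the sum of \<alpha>
    bounds; \<open>Suc\<close> makes the bound strict.\<close>
  have "\<exists>S. (indep_paths Mf S \<and> S0 \<subseteq> S) \<and> (\<forall>T. indep_paths Mf T \<and> S0 \<subseteq> T \<longrightarrow> card T \<le> card S)"
    using S0 indep_paths_bound(2)[OF fr]
    by (intro ex_has_greatest_nat[of _ S0 _ "Suc (sum \<alpha> (verts Q))"]) (auto simp: less_Suc_eq_le)
  then obtain S where S: "indep_paths Mf S" "S0 \<subseteq> S"
    and max: "\<And>T. indep_paths Mf T \<Longrightarrow> S0 \<subseteq> T \<Longrightarrow> card T \<le> card S" by blast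
  \<comment> \<open>A one-step extension \<pi> of \<open>S\<close> whose row is nonzero at some
    vector of the common kernel could be adjoined to \<open>S\<close>, giving a larger independent
    set.\<close>
  have stuck: "path_row Mf \<pi> \<bullet> y = 0"
    if \<pi>: "\<pi> \<in> inf_paths" "fst \<pi> = Vertex i"
      and suffix: "\<And>b p. snd \<pi> = b # p \<Longrightarrow> p \<noteq> [] \<Longrightarrow> (head (ext_quiver Q \<zeta>) b, p) \<in> S"
      and y: "y \<in> carrier_vec (\<alpha> i)" "\<And>\<tau>. \<tau> \<in> paths_at S i \<Longrightarrow> path_row Mf \<tau> \<bullet> y = 0" for \<pi> i y
  proof (rule ccontr)
    assume "path_row Mf \<pi> \<bullet> y \<noteq> 0"
    from indep_paths_insert[OF fr S(1) \<pi> suffix y this] max[of "insert \<pi> S"] S(2)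
      indep_paths_bound(1)[OF fr S(1)]
    show False by auto
  qed
  have Sp: "S \<subseteq> inf_paths" using S by (auto simp: indep_paths_def)
  have "sep_fam (\<alpha> i) (path_row Mf) (paths_at S i)" if "i \<in> verts Q" for i
  proof (rule stable_sep_fam[OF Mf Sp _ _ that])
    fix i q y
    assume "i \<in> verts Q" "q < \<zeta> i" "y \<in> carrier_vec (\<alpha> i)"
      "\<And>\<pi>. \<pi> \<in> paths_at S i \<Longrightarrow> path_row Mf \<pi> \<bullet> y = 0"
    then show "path_row Mf (Vertex i, [Frame i q]) \<bullet> y = 0" by - (rule stuck[of _ i]; simp)
  next
    fix a p y
    assume "a \<in> arcs Q" "(Vertex (head Q a), p) \<in> S" "y \<in> carrier_vec (\<alpha> (tail Q a))"
      "\<And>\<pi>. \<pi> \<in> paths_at S (tail Q a) \<Longrightarrow> path_row Mf \<pi> \<bullet> y = 0"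
    then show "path_row Mf (Vertex (tail Q a), Arrow a # p) \<bullet> y = 0"
      using Sp by - (rule stuck[of _ "tail Q a"]; auto)
  qed
  then show thesis using that S J_skeleta_iff[OF Mf] by blast
qed

lemma indep_paths_empty: "indep_paths Mf {}"
  by (simp add: indep_paths_def suffix_closed_def indep_fam_def paths_at_def)

text \<open>A single frame arrow has no shorter suffix to account for, so it is an independent set
  as soon as its row is nonzero, and it extends to a skeleton.\<close>

lemma frame_in_J_skeleton:
  assumes Mf: "Mf \<in> stable_reps Q \<alpha> \<zeta>" and i: "i \<in> verts Q" and q: "q < \<zeta> i"
    and row: "row (snd Mf i) q \<noteq> 0\<^sub>v (\<alpha> i)"
  shows "\<exists>S\<in>J_skeleta Q \<alpha> \<zeta> Mf. (Vertex i, [Frame i q]) \<in> S"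
proof -
  note fr = stable_reps_framed[OF Mf]
  have c: "row (snd Mf i) q \<in> carrier_vec (\<alpha> i)" using framed_carrier(2)[OF fr i] q by auto
  then obtain j where j: "j < \<alpha> i" "row (snd Mf i) q $ j \<noteq> 0"
    using row by (metis carrier_vecD eq_vecI index_zero_vec)
  have "path_row Mf (Vertex i, [Frame i q]) \<bullet> unit_vec (\<alpha> i) j \<noteq> 0"
    using path_row_frame[OF fr i q] c j by simp
  then have "indep_paths Mf {(Vertex i, [Frame i q])}"
    using i q by (intro indep_paths_insert(1)[OF fr indep_paths_empty, of _ i "unit_vec (\<alpha> i) j"])
      (auto simp: paths_at_def)
  then obtain S where "S \<in> J_skeleta Q \<alpha> \<zeta> Mf" "{(Vertex i, [Frame i q])} \<subseteq> S"
    by (rule extend_to_J_skeleton[OF Mf])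
  then show ?thesis by blast
qed

text \<open>If row \<open>q\<close> of \<open>f\<^sub>i\<close> vanishes, replacing it by a nonzero row shrinks \<open>ker f\<^sub>i\<close> and hence
  preserves stability; so \<open>\<Gamma>(\<alpha>)\<close> contains \<open>f\<^bsub>iq\<^esub>\<close> over every field.\<close>

lemma frame_in_Gamma:
  fixes Mf :: "('v, 'a, 'k :: field) framed"
  assumes Mf: "Mf \<in> stable_reps Q \<alpha> \<zeta>" and i: "i \<in> verts Q" and q: "q < \<zeta> i" and \<alpha>: "\<alpha> i \<noteq> 0"
  shows "(Vertex i, [Frame i q]) \<in> Gamma TYPE('k) Q \<alpha> \<zeta>"
proof -
  note fr = stable_reps_framed[OF Mf]
  note f = framed_carrier(2)[OF fr]
  obtain Mf' :: "('v, 'a, 'k) framed"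
    where Mf': "Mf' \<in> stable_reps Q \<alpha> \<zeta>" "row (snd Mf' i) q \<noteq> 0\<^sub>v (\<alpha> i)"
  proof (cases "row (snd Mf i) q = 0\<^sub>v (\<alpha> i)")
    case True
    \<comment> \<open>The zero row is replaced by the first unit row, which is nonzero because
      \<alpha>_i \<noteq> 0. The remaining rows are kept, so a vector killed by \<open>F\<close> is
      killed by the old \<open>f_i\<close>.\<close>
    define F where "F = mat (\<zeta> i) (\<alpha> i) (\<lambda>(r, c). if r = q then (if c = 0 then 1 else 0) else snd Mf i $$ (r, c))"
    have F: "F \<in> carrier_mat (\<zeta> i) (\<alpha> i)" by (simp add: F_def)
    have ker: "mat_kernel (((snd Mf)(i := F)) j) \<subseteq> mat_kernel (snd Mf j)" if "j \<in> verts Q" for j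
    proof (cases "j = i")
      case [simp]: True
      show ?thesis
      proof
        fix y assume "y \<in> mat_kernel (((snd Mf)(i := F)) j)"
        then have y: "y \<in> carrier_vec (\<alpha> i)" "F *\<^sub>v y = 0\<^sub>v (\<zeta> i)" using mat_kernel[OF F] by auto
        have "snd Mf i *\<^sub>v y = 0\<^sub>v (\<zeta> i)"
        proof (rule eq_vecI)
          fix r assume "r < dim_vec (0\<^sub>v (\<zeta> i) :: 'k vec)"
          then have r: "r < \<zeta> i" by simp
          show "(snd Mf i *\<^sub>v y) $ r = 0\<^sub>v (\<zeta> i) $ r"
          proof (cases "r = q")
            case True
            then show ?thesis using \<open>row (snd Mf i) q = _\<close> f[OF i] r y by simp
          next
            case False
            then have "row (snd Mf i) r = row F r"
              using f[OF i] r by (intro eq_vecI) (auto simp: F_def)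
            moreover have "(F *\<^sub>v y) $ r = 0" using y r by simp
            ultimately show ?thesis using f[OF i] F r by simp
          qed
        qed (use f[OF i] in auto)
        then show "y \<in> mat_kernel (snd Mf j)" using mat_kernel[OF f[OF i]] y by simp
      qed
    qed simp
    have "(fst Mf, (snd Mf)(i := F)) \<in> stable_reps Q \<alpha> \<zeta>"
      unfolding stable_reps_def mem_Collect_eq
    proof
      show "(fst Mf, (snd Mf)(i := F)) \<in> framed_reps Q \<alpha> \<zeta>"
        using fr i F by (auto simp: framed_reps_def PiE_iff extensional_def)
      show "stable Q \<alpha> (fst Mf, (snd Mf)(i := F))"
        unfolding stable_def prod.case
      proof
        assume "\<exists>N. subrep Q \<alpha> (fst Mf) N \<and> (\<exists>j\<in>verts Q. N j \<noteq> {0\<^sub>v (\<alpha> j)}) \<and>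
          (\<forall>j\<in>verts Q. N j \<subseteq> mat_kernel (((snd Mf)(i := F)) j))"
        then obtain N where N: "subrep Q \<alpha> (fst Mf) N" "\<exists>j\<in>verts Q. N j \<noteq> {0\<^sub>v (\<alpha> j)}"
          "\<And>j. j \<in> verts Q \<Longrightarrow> N j \<subseteq> mat_kernel (((snd Mf)(i := F)) j)" by blast
        have "\<forall>j\<in>verts Q. N j \<subseteq> mat_kernel (snd Mf j)" using N(3) ker by blast
        with N(1,2) have "\<not> stable Q \<alpha> Mf" unfolding stable_def case_prod_unfold by blast
        then show False using Mf by (simp add: stable_reps_def)
      qed
    qed
    moreover have "row F q \<noteq> 0\<^sub>v (\<alpha> i)"
    proof
      assume "row F q = 0\<^sub>v (\<alpha> i)"
      then have "row F q $ 0 = 0" using \<alpha> by simp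
      then show False using q \<alpha> by (simp add: F_def)
    qed
    ultimately show thesis using that[of "(fst Mf, (snd Mf)(i := F))"] by simp
  qed (use Mf that in blast)
  then show ?thesis
    using frame_in_J_skeleton[OF Mf'(1) i q Mf'(2)] by (auto simp: Gamma_def J_skeleta_of_dim_def)
qed

end

section \<open>The action of the general linear group\<close>

text \<open>The transposed form matches the way in which \<open>pi_skeleton\<close> multiplies a row
  by a matrix.\<close>

lemma row_mult_mat:
  fixes A B :: "'k :: field mat"
  assumes "A \<in> carrier_mat m n" "B \<in> carrier_mat n l" "r < m"
  shows "row (A * B) r = transpose_mat B *\<^sub>v row A r"
  using assms by (intro eq_vecI) (auto intro!: comm_scalar_prod[of _ n])

lemma invertible_mat_iff_det:
  fixes A :: "'k :: field mat"
  assumes A: "A \<in> carrier_mat n n"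
  shows "invertible_mat A \<longleftrightarrow> det A \<noteq> 0"
proof
  assume "invertible_mat A"
  then obtain B where AB: "A * B = 1\<^sub>m n" and BA: "B * A = 1\<^sub>m (dim_row B)"
    using A by (auto simp: invertible_mat_def inverts_mat_def)
  \<comment> \<open>\<open>invertible_mat\<close> leaves the size of \<open>B\<close> open;
    comparing the numbers of columns in both products determines it.\<close>
  have "B \<in> carrier_mat n n"
    using arg_cong[OF AB, of dim_col] arg_cong[OF BA, of dim_col] A by auto
  then have "det A * det B = 1" using AB det_mult[OF A] by (metis det_one)
  then show "det A \<noteq> 0" by auto
next
  assume "det A \<noteq> 0"
  from mat_inv_mult[OF A this] A show "invertible_mat A"
    by (auto simp: invertible_mat_def inverts_mat_def)
qed

lemma mat_inv_unique:
  fixes A :: "'k :: field mat"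
  assumes A: "A \<in> carrier_mat n n" and B: "B \<in> carrier_mat n n" and AB: "A * B = 1\<^sub>m n"
  shows "mat_inv A = B"
proof -
  have "det A * det B = 1" using AB det_mult[OF A B] by (metis det_one)
  then have "det A \<noteq> 0" by auto
  note inv = mat_inv_mult[OF A this]
  have "mat_inv A = mat_inv A * (A * B)" using inv(1) by (simp add: AB)
  also have "\<dots> = (mat_inv A * A) * B" using inv(1) A B by simp
  also have "\<dots> = B" using inv(3) B by simp
  finally show ?thesis .
qed

lemma mult_mat_zero_vec: "A \<in> carrier_mat m n \<Longrightarrow> A *\<^sub>v 0\<^sub>v n = 0\<^sub>v m"
  by (intro eq_vecI) auto

context framed_quiver
begin

lemma GL_D:
  assumes "g \<in> GL Q \<alpha>" "i \<in> verts Q"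
  shows "g i \<in> carrier_mat (\<alpha> i) (\<alpha> i)" "det (g i) \<noteq> 0" "mat_inv (g i) \<in> carrier_mat (\<alpha> i) (\<alpha> i)"
    "g i * mat_inv (g i) = 1\<^sub>m (\<alpha> i)" "mat_inv (g i) * g i = 1\<^sub>m (\<alpha> i)"
proof -
  have *: "g i \<in> carrier_mat (\<alpha> i) (\<alpha> i)" "invertible_mat (g i)" using assms by (auto simp: GL_def)
  then show "g i \<in> carrier_mat (\<alpha> i) (\<alpha> i)" "det (g i) \<noteq> 0"
    using invertible_mat_iff_det by auto
  from mat_inv_mult[OF this]
  show "mat_inv (g i) \<in> carrier_mat (\<alpha> i) (\<alpha> i)"
    "g i * mat_inv (g i) = 1\<^sub>m (\<alpha> i)" "mat_inv (g i) * g i = 1\<^sub>m (\<alpha> i)" .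
qed

lemma GL_I:
  assumes "\<And>i. i \<in> verts Q \<Longrightarrow> g i \<in> carrier_mat (\<alpha> i) (\<alpha> i) \<and> det (g i) \<noteq> 0"
  shows "(\<lambda>i\<in>verts Q. g i) \<in> GL Q \<alpha>"
  using assms invertible_mat_iff_det by (auto simp: GL_def)

lemma GL_act_carrier:
  assumes g: "g \<in> GL Q \<alpha>" and Mf: "Mf \<in> framed_reps Q \<alpha> \<zeta>"
  shows "GL_act Q g Mf \<in> framed_reps Q \<alpha> \<zeta>"
proof -
  have "g (head Q a) * fst Mf a * mat_inv (g (tail Q a)) \<in> carrier_mat (\<alpha> (head Q a)) (\<alpha> (tail Q a))"
    if a: "a \<in> arcs Q" for a
    using framed_carrier(1)[OF Mf a] GL_D(1)[OF g head_in_verts[OF a]] GL_D(3)[OF g tail_in_verts[OF a]]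
    by (meson mult_carrier_mat)
  moreover have "snd Mf i * mat_inv (g i) \<in> carrier_mat (\<zeta> i) (\<alpha> i)" if i: "i \<in> verts Q" for i
    using framed_carrier(2)[OF Mf i] GL_D(3)[OF g i] by (rule mult_carrier_mat)
  ultimately show ?thesis by (simp add: GL_act_def framed_reps_def case_prod_unfold)
qed

lemma GL_act_comp:
  assumes g: "g \<in> GL Q \<alpha>" and h: "h \<in> GL Q \<alpha>" and Mf: "Mf \<in> framed_reps Q \<alpha> \<zeta>"
  shows "GL_act Q g (GL_act Q h Mf) = GL_act Q (\<lambda>i\<in>verts Q. g i * h i) Mf"
proof -
  have inv: "mat_inv (g i * h i) = mat_inv (h i) * mat_inv (g i)" if i: "i \<in> verts Q" for i
  proof (rule mat_inv_unique)
    note G = GL_D[OF g i] and H = GL_D[OF h i]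
    have "h i * (mat_inv (h i) * mat_inv (g i)) = h i * mat_inv (h i) * mat_inv (g i)"
      using G H by (intro assoc_mult_mat[symmetric]) auto
    also have "\<dots> = mat_inv (g i)" unfolding H(4) using G by simp
    finally have "g i * (h i * (mat_inv (h i) * mat_inv (g i))) = 1\<^sub>m (\<alpha> i)" using G(4) by simp
    moreover have "g i * h i * (mat_inv (h i) * mat_inv (g i)) = g i * (h i * (mat_inv (h i) * mat_inv (g i)))"
      using G H by (intro assoc_mult_mat) (auto intro!: mult_carrier_mat)
    ultimately show "g i * h i * (mat_inv (h i) * mat_inv (g i)) = 1\<^sub>m (\<alpha> i)" by simp
  qed (use GL_D[OF g i] GL_D[OF h i] in \<open>auto intro!: mult_carrier_mat\<close>)
  show ?thesis
  proof (rule prod_eqI)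
    show "fst (GL_act Q g (GL_act Q h Mf)) = fst (GL_act Q (\<lambda>i\<in>verts Q. g i * h i) Mf)"
    proof
      fix a
      show "fst (GL_act Q g (GL_act Q h Mf)) a = fst (GL_act Q (\<lambda>i\<in>verts Q. g i * h i) Mf) a"
      proof (cases "a \<in> arcs Q")
        case True
        define t u where "t = tail Q a" and "u = head Q a"
        have v: "t \<in> verts Q" "u \<in> verts Q" using True by (auto simp: t_def u_def)
        note c = GL_D[OF g v(1)] GL_D[OF h v(1)] GL_D[OF g v(2)] GL_D[OF h v(2)]
          framed_carrier(1)[OF Mf True, folded t_def u_def]
        have "g u * (h u * fst Mf a * mat_inv (h t)) * mat_inv (g t) =
            g u * h u * fst Mf a * (mat_inv (h t) * mat_inv (g t))"
        proof -
          have "g u * (h u * fst Mf a * mat_inv (h t)) = g u * (h u * fst Mf a) * mat_inv (h t)"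
            using c by (intro assoc_mult_mat[symmetric]) (auto intro!: mult_carrier_mat)
          also have "g u * (h u * fst Mf a) = g u * h u * fst Mf a"
            using c by (intro assoc_mult_mat[symmetric]) auto
          also have "g u * h u * fst Mf a * mat_inv (h t) * mat_inv (g t) =
              g u * h u * fst Mf a * (mat_inv (h t) * mat_inv (g t))"
            using c by (intro assoc_mult_mat[of _ "\<alpha> u" "\<alpha> t"]) (auto intro!: mult_carrier_mat)
          finally show ?thesis .
        qed
        then show ?thesis
          using True v inv by (simp add: GL_act_def case_prod_unfold t_def u_def)
      qed (simp add: GL_act_def case_prod_unfold)
    qed
    show "snd (GL_act Q g (GL_act Q h Mf)) = snd (GL_act Q (\<lambda>i\<in>verts Q. g i * h i) Mf)"
    proof
      fix i
      show "snd (GL_act Q g (GL_act Q h Mf)) i = snd (GL_act Q (\<lambda>i\<in>verts Q. g i * h i) Mf) i"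
      proof (cases "i \<in> verts Q")
        case True
        have "snd Mf i * mat_inv (h i) * mat_inv (g i) = snd Mf i * (mat_inv (h i) * mat_inv (g i))"
          using framed_carrier(2)[OF Mf True] GL_D[OF g True] GL_D[OF h True]
          by (intro assoc_mult_mat) auto
        then show ?thesis using True inv by (simp add: GL_act_def case_prod_unfold)
      qed (simp add: GL_act_def case_prod_unfold)
    qed
  qed
qed

lemma GL_act_cong:
  assumes "\<And>i. i \<in> verts Q \<Longrightarrow> g i = h i"
  shows "GL_act Q g Mf = GL_act Q h Mf"
  using assms by (auto simp: GL_act_def case_prod_unfold intro!: restrict_ext)

lemma GL_act_one:
  fixes Mf :: "('v, 'a, 'k :: field) framed"
  assumes Mf: "Mf \<in> framed_reps Q \<alpha> \<zeta>"
  shows "GL_act Q (\<lambda>i\<in>verts Q. 1\<^sub>m (\<alpha> i)) Mf = Mf"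
proof -
  have inv: "mat_inv (1\<^sub>m n) = (1\<^sub>m n :: 'k mat)" for n by (rule mat_inv_unique) auto
  have ext: "fst Mf \<in> extensional (arcs Q)" "snd Mf \<in> extensional (verts Q)"
    using Mf by (auto simp: framed_reps_def PiE_def)
  have one: "1\<^sub>m (\<alpha> (head Q a)) * fst Mf a * 1\<^sub>m (\<alpha> (tail Q a)) = fst Mf a" if "a \<in> arcs Q" for a
    using framed_carrier(1)[OF Mf that] by simp
  have "fst (GL_act Q (\<lambda>i\<in>verts Q. 1\<^sub>m (\<alpha> i)) Mf) = fst Mf"
    using one by (intro extensionalityI[OF _ ext(1)]) (simp_all add: GL_act_def case_prod_unfold inv)
  moreover have "snd (GL_act Q (\<lambda>i\<in>verts Q. 1\<^sub>m (\<alpha> i)) Mf) = snd Mf"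
    using right_mult_one_mat[OF framed_carrier(2)[OF Mf]]
    by (intro extensionalityI[OF _ ext(2)]) (simp_all add: GL_act_def case_prod_unfold inv)
  ultimately show ?thesis by (rule prod_eqI)
qed

lemma GL_inverse:
  assumes g: "g \<in> GL Q \<alpha>"
  shows "(\<lambda>i\<in>verts Q. mat_inv (g i)) \<in> GL Q \<alpha>"
proof (rule GL_I)
  fix i assume i: "i \<in> verts Q"
  note G = GL_D[OF g i]
  have "det (g i) * det (mat_inv (g i)) = 1" using G det_mult[OF G(1,3)] by (metis det_one)
  then show "mat_inv (g i) \<in> carrier_mat (\<alpha> i) (\<alpha> i) \<and> det (mat_inv (g i)) \<noteq> 0" using G by auto
qed

lemma GL_mult:
  assumes "g \<in> GL Q \<alpha>" "h \<in> GL Q \<alpha>"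
  shows "(\<lambda>i\<in>verts Q. g i * h i) \<in> GL Q \<alpha>"
proof (rule GL_I)
  fix i assume i: "i \<in> verts Q"
  show "g i * h i \<in> carrier_mat (\<alpha> i) (\<alpha> i) \<and> det (g i * h i) \<noteq> 0"
    using GL_D[OF assms(1) i] GL_D[OF assms(2) i] det_mult[of "g i" "\<alpha> i" "h i"] by auto
qed

lemma isomorphic_if_common_orbit:
  assumes g: "g \<in> GL Q \<alpha>" and h: "h \<in> GL Q \<alpha>"
    and Mf: "Mf \<in> framed_reps Q \<alpha> \<zeta>" and Mf': "Mf' \<in> framed_reps Q \<alpha> \<zeta>"
    and eq: "GL_act Q g Mf = GL_act Q h Mf'"
  shows "isomorphic Q \<alpha> Mf Mf'"
proof -
  \<comment> \<open>The base change carrying \<open>Mf\<close> to \<open>Mf'\<close> is h^-1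
    g.\<close>
  let ?h = "\<lambda>i\<in>verts Q. mat_inv (h i)"
  note h' = GL_inverse[OF h]
  have "GL_act Q (\<lambda>i\<in>verts Q. ?h i * g i) Mf = GL_act Q ?h (GL_act Q h Mf')"
    using GL_act_comp[OF h' g Mf] eq by simp
  also have "\<dots> = GL_act Q (\<lambda>i\<in>verts Q. 1\<^sub>m (\<alpha> i)) Mf'"
    unfolding GL_act_comp[OF h' h Mf'] by (rule GL_act_cong) (simp add: GL_D[OF h])
  also have "\<dots> = Mf'" by (rule GL_act_one[OF Mf'])
  finally show ?thesis
    unfolding isomorphic_def using GL_mult[OF h' g] by (intro bexI) auto
qed

section \<open>Invariance of stability and of path evaluations\<close>

lemma GL_act_stable:
  fixes Mf :: "('v, 'a, 'k :: field) framed"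
  assumes g: "g \<in> GL Q \<alpha>" and Mf: "Mf \<in> stable_reps Q \<alpha> \<zeta>"
  shows "GL_act Q g Mf \<in> stable_reps Q \<alpha> \<zeta>"
proof -
  note fr = stable_reps_framed[OF Mf]
  have "stable Q \<alpha> (GL_act Q g Mf)"
    unfolding stable_def case_prod_unfold
  proof
    assume "\<exists>N. subrep Q \<alpha> (fst (GL_act Q g Mf)) N \<and> (\<exists>i\<in>verts Q. N i \<noteq> {0\<^sub>v (\<alpha> i)}) \<and>
      (\<forall>i\<in>verts Q. N i \<subseteq> mat_kernel (snd (GL_act Q g Mf) i))"
    then obtain N i where sub: "subrep Q \<alpha> (fst (GL_act Q g Mf)) N"
      and i: "i \<in> verts Q" "N i \<noteq> {0\<^sub>v (\<alpha> i)}"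
      and ker: "\<And>i. i \<in> verts Q \<Longrightarrow> N i \<subseteq> mat_kernel (snd (GL_act Q g Mf) i)" by blast
    \<comment> \<open>A destabilizing \<open>N\<close> for the transformed pair is pulled back along
      g. The preimage is a subrepresentation of M inside the kernel of f, and it is nonzero where
      \<open>N\<close> is because g is bijective.\<close>
    define L where "L j = {x \<in> carrier_vec (\<alpha> j). g j *\<^sub>v x \<in> N j}" for j
    have N: "VectorSpace.subspace class_ring (N j) (module_vec TYPE('k) (\<alpha> j))" if "j \<in> verts Q" for j
      using sub that by (simp add: subrep_def)
    have "subrep Q \<alpha> (fst Mf) L"
      unfolding subrep_def
    proof (intro conjI ballI)
      fix j assume j: "j \<in> verts Q"
      note G = GL_D(1)[OF g j] and S = subspace_vecD[OF N[OF j]]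
      show "VectorSpace.subspace class_ring (L j) (module_vec TYPE('k) (\<alpha> j))"
      proof (rule subspace_vecI)
        show "0\<^sub>v (\<alpha> j) \<in> L j" using S(2) mult_mat_zero_vec[OF G] by (simp add: L_def)
        show "x + y \<in> L j" if "x \<in> L j" "y \<in> L j" for x y
          using that S(3) mult_add_distrib_mat_vec[OF G] by (simp add: L_def)
        show "c \<cdot>\<^sub>v x \<in> L j" if "x \<in> L j" for c x
          using that S(4) mult_mat_vec[OF G] by (simp add: L_def)
      qed (auto simp: L_def)
    next
      fix a x assume a: "a \<in> arcs Q" and x: "x \<in> L (tail Q a)"
      note G = GL_D[OF g tail_in_verts[OF a]] and H = GL_D[OF g head_in_verts[OF a]]
      note M = framed_carrier(1)[OF fr a]
      have xc: "x \<in> carrier_vec (\<alpha> (tail Q a))" using x by (simp add: L_def)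
      have xx: "mat_inv (g (tail Q a)) *\<^sub>v (g (tail Q a) *\<^sub>v x) = x"
        using G xc by (subst assoc_mult_mat_vec[symmetric]) auto
      have "fst (GL_act Q g Mf) a *\<^sub>v (g (tail Q a) *\<^sub>v x) =
          (g (head Q a) * fst Mf a) *\<^sub>v (mat_inv (g (tail Q a)) *\<^sub>v (g (tail Q a) *\<^sub>v x))"
        using G H(1) M xc a
        by (subst assoc_mult_mat_vec[symmetric, of _ "\<alpha> (head Q a)" "\<alpha> (tail Q a)"])
          (auto simp: GL_act_def case_prod_unfold)
      also have "\<dots> = g (head Q a) *\<^sub>v (fst Mf a *\<^sub>v x)"
        unfolding xx using H(1) M xc by simp
      finally have eq: "fst (GL_act Q g Mf) a *\<^sub>v (g (tail Q a) *\<^sub>v x) = g (head Q a) *\<^sub>v (fst Mf a *\<^sub>v x)" .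
      have "fst (GL_act Q g Mf) a *\<^sub>v (g (tail Q a) *\<^sub>v x) \<in> N (head Q a)"
        using sub a x unfolding subrep_def L_def by blast
      then have "g (head Q a) *\<^sub>v (fst Mf a *\<^sub>v x) \<in> N (head Q a)" unfolding eq .
      then show "fst Mf a *\<^sub>v x \<in> L (head Q a)" using M xc by (auto simp: L_def)
    qed
    moreover have "L j \<subseteq> mat_kernel (snd Mf j)" if j: "j \<in> verts Q" for j
    proof
      fix x assume x: "x \<in> L j"
      then have xc: "x \<in> carrier_vec (\<alpha> j)" by (simp add: L_def)
      note G = GL_D[OF g j] and F = framed_carrier(2)[OF fr j]
      have "snd Mf j *\<^sub>v x = snd Mf j *\<^sub>v (mat_inv (g j) *\<^sub>v (g j *\<^sub>v x))"
        using G xc by (subst assoc_mult_mat_vec[symmetric, of "mat_inv (g j)"]) auto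
      also have "\<dots> = snd (GL_act Q g Mf) j *\<^sub>v (g j *\<^sub>v x)"
        using G F xc j by (subst assoc_mult_mat_vec[symmetric, of "snd Mf j" "\<zeta> j" "\<alpha> j"])
          (auto simp: GL_act_def case_prod_unfold)
      also have "\<dots> = 0\<^sub>v (\<zeta> j)"
        using ker[OF j] x mat_kernelD(2)[OF framed_carrier(2)[OF GL_act_carrier[OF g fr] j]]
        by (auto simp: L_def)
      finally show "x \<in> mat_kernel (snd Mf j)" using mat_kernelI[OF F xc] by simp
    qed
    moreover have "L i \<noteq> {0\<^sub>v (\<alpha> i)}"
    proof
      assume L: "L i = {0\<^sub>v (\<alpha> i)}"
      note G = GL_D[OF g i(1)] and S = subspace_vecD[OF N[OF i(1)]]
      obtain y where y: "y \<in> N i" "y \<noteq> 0\<^sub>v (\<alpha> i)" using S(2) i(2) by blast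
      then have yc: "y \<in> carrier_vec (\<alpha> i)" using S(1) by blast
      have gy: "g i *\<^sub>v (mat_inv (g i) *\<^sub>v y) = y"
        using G yc by (subst assoc_mult_mat_vec[symmetric]) auto
      then have "mat_inv (g i) *\<^sub>v y \<in> L i" using G yc y by (auto simp: L_def)
      then have "mat_inv (g i) *\<^sub>v y = 0\<^sub>v (\<alpha> i)" using L by simp
      then show False using gy y(2) mult_mat_zero_vec[OF G(1)] by simp
    qed
    ultimately have "\<not> stable Q \<alpha> Mf"
      using i(1) unfolding stable_def case_prod_unfold by blast
    then show False using Mf by (simp add: stable_reps_def)
  qed
  then show ?thesis using GL_act_carrier[OF g fr] by (simp add: stable_reps_def)
qed

text \<open>Along a path the base changes at the inner vertices cancel, and nothing acts at
  \<infinity>; only the inverse of \<open>g i\<close> at the tail remains. Evaluating at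
  \<open>g i *\<^sub>v y\<close> absorbs it.\<close>

lemma path_row_GL_act:
  fixes Mf :: "('v, 'a, 'k :: field) framed"
  assumes g: "g \<in> GL Q \<alpha>" and Mf: "Mf \<in> framed_reps Q \<alpha> \<zeta>"
    and "(Vertex i, p) \<in> inf_paths" "i \<in> verts Q" "y \<in> carrier_vec (\<alpha> i)"
  shows "path_row (GL_act Q g Mf) (Vertex i, p) \<bullet> (g i *\<^sub>v y) = path_row Mf (Vertex i, p) \<bullet> y"
  using assms(3-)
proof (induction p arbitrary: i y)
  case (Cons b p)
  note gfr = GL_act_carrier[OF g Mf]
  note G = GL_D[OF g Cons.prems(2)]
  note y = Cons.prems(3)
  have inv: "mat_inv (g i) *\<^sub>v (g i *\<^sub>v y) = y"
    using G y by (subst assoc_mult_mat_vec[symmetric]) auto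
  show ?case
  proof (cases b)
    case (Arrow a)
    then have i: "i = tail Q a" and a: "a \<in> arcs Q" and p: "(Vertex (head Q a), p) \<in> inf_paths"
      using Cons.prems by auto
    note H = GL_D[OF g head_in_verts[OF a]] and M = framed_carrier(1)[OF Mf a]
    have "fst (GL_act Q g Mf) a *\<^sub>v (g i *\<^sub>v y) = (g (head Q a) * fst Mf a) *\<^sub>v (mat_inv (g i) *\<^sub>v (g i *\<^sub>v y))"
      using a i G H(1) M y
      by (subst assoc_mult_mat_vec[symmetric, of _ "\<alpha> (head Q a)" "\<alpha> i"])
        (auto simp: GL_act_def case_prod_unfold)
    also have "\<dots> = g (head Q a) *\<^sub>v (fst Mf a *\<^sub>v y)"
      unfolding inv using H(1) M y i by simp
    finally have *: "fst (GL_act Q g Mf) a *\<^sub>v (g i *\<^sub>v y) = g (head Q a) *\<^sub>v (fst Mf a *\<^sub>v y)" .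
    have "path_row (GL_act Q g Mf) (Vertex i, b # p) \<bullet> (g i *\<^sub>v y) =
        path_row (GL_act Q g Mf) (Vertex (head Q a), p) \<bullet> (g (head Q a) *\<^sub>v (fst Mf a *\<^sub>v y))"
      using path_row_arrow[OF gfr a p, of "g i *\<^sub>v y"] G y i Arrow * by simp
    also have "\<dots> = path_row Mf (Vertex (head Q a), p) \<bullet> (fst Mf a *\<^sub>v y)"
      using M y i head_in_verts[OF a] by (intro Cons.IH p) auto
    also have "\<dots> = path_row Mf (Vertex i, b # p) \<bullet> y"
      using path_row_arrow[OF Mf a p, of y] y i Arrow by simp
    finally show ?thesis .
  next
    case (Frame j q)
    then have q: "q < \<zeta> i" and p: "p = []" "j = i" using Cons.prems by auto
    note F = framed_carrier(2)[OF Mf Cons.prems(2)]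
    have "snd (GL_act Q g Mf) i *\<^sub>v (g i *\<^sub>v y) = snd Mf i *\<^sub>v (mat_inv (g i) *\<^sub>v (g i *\<^sub>v y))"
      using F G y Cons.prems(2) by (subst assoc_mult_mat_vec[symmetric, of "snd Mf i" "\<zeta> i" "\<alpha> i"])
        (auto simp: GL_act_def case_prod_unfold)
    also have "\<dots> = snd Mf i *\<^sub>v y" unfolding inv ..
    finally have "(snd (GL_act Q g Mf) i *\<^sub>v (g i *\<^sub>v y)) $ q = (snd Mf i *\<^sub>v y) $ q" by simp
    then show ?thesis
      using Frame p q path_row_frame[OF gfr Cons.prems(2) q] path_row_frame[OF Mf Cons.prems(2) q]
        F framed_carrier(2)[OF gfr Cons.prems(2)] by simp
  qed
qed simp

section \<open>Minors and normal forms\<close>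

context
  fixes ord :: "('v, 'a) path_order"
  assumes ord: "is_path_order TYPE('k :: field) Q \<alpha> \<zeta> ord"
begin

abbreviation minor :: "('v, 'a) qpath set \<Rightarrow> ('v, 'a, 'k) framed \<Rightarrow> 'v \<Rightarrow> 'k mat" where
  "minor S Mf i \<equiv> skeleton_minor_mat \<alpha> ord S (Phi_hat Q \<alpha> \<zeta> Mf) i"

lemma Phi_hat_eq:
  "i \<in> verts Q \<Longrightarrow> \<pi> \<in> Gamma_tilde TYPE('k) Q \<alpha> \<zeta> \<Longrightarrow> fst \<pi> = Vertex i \<Longrightarrow>
    Phi_hat Q \<alpha> \<zeta> (Mf :: ('v, 'a, 'k) framed) i \<pi> = path_row Mf \<pi>"
  by (simp add: Phi_hat_def path_row_def paths_at_def)

text \<open>These are properties of \<SS> alone, read off from any stable pair that has \<SS> as a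
  skeleton. In particular the minors for \<SS> are square for every pair, whether or not \<SS> is
  one of its skeleta.\<close>

lemma skeletaD:
  assumes "S \<in> J_skeleta_of_dim TYPE('k) Q \<alpha> \<zeta>"
  shows "S \<subseteq> inf_paths - {inf_path}" "suffix_closed S" "S \<subseteq> Gamma TYPE('k) Q \<alpha> \<zeta>"
    "i \<in> verts Q \<Longrightarrow> distinct (ord S i)" "i \<in> verts Q \<Longrightarrow> set (ord S i) = paths_at S i"
    "i \<in> verts Q \<Longrightarrow> length (ord S i) = \<alpha> i"
proof -
  obtain Mf :: "('v, 'a, 'k) framed" where Mf: "Mf \<in> stable_reps Q \<alpha> \<zeta>" and S: "S \<in> J_skeleta Q \<alpha> \<zeta> Mf"
    using assms by (auto simp: J_skeleta_of_dim_def)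
  then have *: "indep_paths Mf S" "\<forall>i\<in>verts Q. sep_fam (\<alpha> i) (path_row Mf) (paths_at S i)"
    using J_skeleta_iff[OF Mf] by blast+
  then show sub: "S \<subseteq> inf_paths - {inf_path}" "suffix_closed S" by (auto simp: indep_paths_def)
  show "S \<subseteq> Gamma TYPE('k) Q \<alpha> \<zeta>" using assms by (auto simp: Gamma_def)
  assume i: "i \<in> verts Q"
  then show o: "distinct (ord S i)" "set (ord S i) = paths_at S i"
    using ord assms by (auto simp: is_path_order_def)
  have "path_row Mf \<pi> \<in> carrier_vec (\<alpha> i)" if "\<pi> \<in> paths_at S i" for \<pi>
    using that sub path_row_carrier[OF stable_reps_framed[OF Mf], of \<pi>] by (auto simp: paths_at_def)
  from indep_sep_iff_det[where v = "path_row Mf" and n = "\<alpha> i", OF o this] * i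
  show "length (ord S i) = \<alpha> i" by (auto simp: indep_paths_def)
qed

lemma minor_eq:
  assumes "S \<in> J_skeleta_of_dim TYPE('k) Q \<alpha> \<zeta>" "i \<in> verts Q"
  shows "minor S Mf i = mat_of_rows (\<alpha> i) (map (path_row Mf) (ord S i))"
proof -
  have "Phi_hat Q \<alpha> \<zeta> Mf i \<pi> = path_row Mf \<pi>" if "\<pi> \<in> set (ord S i)" for \<pi>
    using that skeletaD(3,5)[OF assms(1)] assms(2)
    by (intro Phi_hat_eq) (auto simp: paths_at_def Gamma_tilde_def)
  then show ?thesis by (simp add: skeleton_minor_mat_def cong: map_cong)
qed

lemma minor_carrier:
  "S \<in> J_skeleta_of_dim TYPE('k) Q \<alpha> \<zeta> \<Longrightarrow> i \<in> verts Q \<Longrightarrow> minor S Mf i \<in> carrier_mat (\<alpha> i) (\<alpha> i)"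
  using mat_of_rows_carrier(1)[of "\<alpha> i" "map (path_row Mf) (ord S i)"]
  by (simp add: minor_eq skeletaD(6))

lemma skeleton_path_row:
  assumes "Mf \<in> framed_reps Q \<alpha> \<zeta>" "S \<in> J_skeleta_of_dim TYPE('k) Q \<alpha> \<zeta>" "\<pi> \<in> paths_at S i"
  shows "path_row Mf \<pi> \<in> carrier_vec (\<alpha> i)"
  using assms(3) skeletaD(1)[OF assms(2)] path_row_carrier[OF assms(1), of \<pi>] by (auto simp: paths_at_def)

lemma row_minor:
  assumes "Mf \<in> framed_reps Q \<alpha> \<zeta>" "S \<in> J_skeleta_of_dim TYPE('k) Q \<alpha> \<zeta>" "i \<in> verts Q" "r < \<alpha> i"
  shows "row (minor S Mf i) r = path_row Mf (ord S i ! r)"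
proof -
  have "ord S i ! r \<in> paths_at S i" using skeletaD(5,6)[OF assms(2,3)] assms(4) nth_mem by metis
  then show ?thesis
    using skeletaD(6)[OF assms(2,3)] assms(4) skeleton_path_row[OF assms(1,2)]
    unfolding minor_eq[OF assms(2,3)] by (subst mat_of_rows_row) auto
qed

text \<open>For a candidate of dimension \<alpha> the combinatorial conditions hold already. What
  depends on the pair is independence and separation at each vertex, and this is the determinant
  criterion.\<close>

lemma skeleta_by_minors_eq:
  assumes Mf: "(Mf :: ('v, 'a, 'k) framed) \<in> stable_reps Q \<alpha> \<zeta>"
  shows "skeleta_by_minors Q \<alpha> \<zeta> ord (Phi_hat Q \<alpha> \<zeta> Mf) = J_skeleta Q \<alpha> \<zeta> Mf"
proof -
  have "S \<in> J_skeleta Q \<alpha> \<zeta> Mf \<longleftrightarrow> (\<forall>i\<in>verts Q. det (minor S Mf i) \<noteq> 0)" if S: "S \<in> J_skeleta_of_dim TYPE('k) Q \<alpha> \<zeta>" for S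
  proof -
    have "S \<in> J_skeleta Q \<alpha> \<zeta> Mf \<longleftrightarrow>
      (\<forall>i\<in>verts Q. indep_fam (\<alpha> i) (path_row Mf) (paths_at S i) \<and> sep_fam (\<alpha> i) (path_row Mf) (paths_at S i))"
      using skeletaD(1,2)[OF S] unfolding J_skeleta_iff[OF Mf] indep_paths_def by blast
    also have "\<dots> \<longleftrightarrow> (\<forall>i\<in>verts Q. det (minor S Mf i) \<noteq> 0)"
    proof (rule ball_cong[OF refl])
      fix i assume i: "i \<in> verts Q"
      show "indep_fam (\<alpha> i) (path_row Mf) (paths_at S i) \<and> sep_fam (\<alpha> i) (path_row Mf) (paths_at S i) \<longleftrightarrow>
          det (minor S Mf i) \<noteq> 0"
        using indep_sep_iff_det[OF skeletaD(4,5)[OF S i] skeleton_path_row[OF stable_reps_framed[OF Mf] S]]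
          skeletaD(6)[OF S i] minor_eq[OF S i] by simp
    qed
    finally show ?thesis .
  qed
  moreover have "J_skeleta Q \<alpha> \<zeta> Mf \<subseteq> J_skeleta_of_dim TYPE('k) Q \<alpha> \<zeta>" using Mf by (auto simp: J_skeleta_of_dim_def)
  ultimately show ?thesis by (auto simp: skeleta_by_minors_def)
qed

lemma J_skeletonD:
  assumes "(Mf :: ('v, 'a, 'k) framed) \<in> stable_reps Q \<alpha> \<zeta>" "S \<in> J_skeleta Q \<alpha> \<zeta> Mf"
  shows "S \<in> J_skeleta_of_dim TYPE('k) Q \<alpha> \<zeta>" "i \<in> verts Q \<Longrightarrow> det (minor S Mf i) \<noteq> 0"
  using assms skeleta_by_minors_eq[OF assms(1)] by (auto simp: skeleta_by_minors_def)

text \<open>The transformation rule of the minors, cleared of the inverse so that entries can be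
  compared: column s of \<open>g i\<close> is \<open>g i\<close> applied to a unit vector, and there
  the two path evaluations agree.\<close>

lemma minor_GL_act:
  assumes g: "g \<in> GL Q \<alpha>" and Mf: "Mf \<in> framed_reps Q \<alpha> \<zeta>" and S: "S \<in> J_skeleta_of_dim TYPE('k) Q \<alpha> \<zeta>" and i: "i \<in> verts Q"
  shows "minor S (GL_act Q g Mf) i * g i = minor S Mf i"
proof (rule eq_matI)
  note G = GL_D[OF g i]
  note c = minor_carrier[OF S i]
  fix r s assume "r < dim_row (minor S Mf i)" "s < dim_col (minor S Mf i)"
  then have rs: "r < \<alpha> i" "s < \<alpha> i" using c[of Mf] by auto
  have p: "ord S i ! r \<in> paths_at S i" using skeletaD(5,6)[OF S i] rs nth_mem by metis
  have "(minor S (GL_act Q g Mf) i * g i) $$ (r, s) = path_row (GL_act Q g Mf) (ord S i ! r) \<bullet> col (g i) s"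
    using rs G c[of "GL_act Q g Mf"] row_minor[OF GL_act_carrier[OF g Mf] S i] by simp
  also have "col (g i) s = g i *\<^sub>v unit_vec (\<alpha> i) s"
    using G rs by (intro eq_vecI) auto
  also have "path_row (GL_act Q g Mf) (ord S i ! r) \<bullet> (g i *\<^sub>v unit_vec (\<alpha> i) s) =
      path_row Mf (ord S i ! r) \<bullet> unit_vec (\<alpha> i) s"
    using path_row_GL_act[OF g Mf, of i "snd (ord S i ! r)" "unit_vec (\<alpha> i) s"] p skeletaD(1)[OF S] i
    by (cases "ord S i ! r") (auto simp: paths_at_def)
  also have "\<dots> = minor S Mf i $$ (r, s)"
    using skeleton_path_row[OF Mf S p] rs row_minor[OF Mf S i, of r, symmetric] c[of Mf] by simp
  finally show "(minor S (GL_act Q g Mf) i * g i) $$ (r, s) = minor S Mf i $$ (r, s)" .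
qed (use GL_D[OF g i] minor_carrier[OF S i, of Mf] minor_carrier[OF S i, of "GL_act Q g Mf"] in auto)

text \<open>The minors of the two pairs differ by the nonzero factor det(g_i), so they vanish
  together.\<close>

lemma J_skeleta_GL_act:
  assumes g: "g \<in> GL Q \<alpha>" and Mf: "(Mf :: ('v, 'a, 'k) framed) \<in> stable_reps Q \<alpha> \<zeta>"
  shows "J_skeleta Q \<alpha> \<zeta> (GL_act Q g Mf) = J_skeleta Q \<alpha> \<zeta> Mf"
proof -
  have "det (minor S (GL_act Q g Mf) i) = 0 \<longleftrightarrow> det (minor S Mf i) = 0"
    if S: "S \<in> J_skeleta_of_dim TYPE('k) Q \<alpha> \<zeta>" and i: "i \<in> verts Q" for S i
    using minor_GL_act[OF g stable_reps_framed[OF Mf] S i, symmetric] GL_D[OF g i]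
      det_mult[OF minor_carrier[OF S i, of "GL_act Q g Mf"] GL_D(1)[OF g i]] by simp
  then have "skeleta_by_minors Q \<alpha> \<zeta> ord (Phi_hat Q \<alpha> \<zeta> (GL_act Q g Mf)) =
      skeleta_by_minors Q \<alpha> \<zeta> ord (Phi_hat Q \<alpha> \<zeta> Mf)"
    unfolding skeleta_by_minors_def by blast
  then show ?thesis using skeleta_by_minors_eq[OF Mf] skeleta_by_minors_eq[OF GL_act_stable[OF g Mf]] by simp
qed

text \<open>Both kinds of rows in the normal form obey one formula, the row of \<pi> times the
  inverse of B(\<SS>_i). For \<pi> in \<SS> the result is a row of B(\<SS>_i) B(\<SS>_i)^-1 = 1, a
  unit row.\<close>

lemma nf_row_eq:
  assumes Mf: "(Mf :: ('v, 'a, 'k) framed) \<in> stable_reps Q \<alpha> \<zeta>" and S: "S \<in> J_skeleta Q \<alpha> \<zeta> Mf" and i: "i \<in> verts Q"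
    and \<pi>: "fst \<pi> = Vertex i" "\<pi> \<in> inf_paths" "\<pi> \<in> S \<or> \<pi> \<in> hat_skeleton Q \<zeta> S i"
    and \<Gamma>: "\<pi> \<in> Gamma_tilde TYPE('k) Q \<alpha> \<zeta> \<or> \<alpha> i = 0"
  shows "nf_row \<alpha> ord S (pi_skeleton Q \<alpha> \<zeta> ord S Mf) i \<pi> =
    transpose_mat (mat_inv (minor S Mf i)) *\<^sub>v path_row Mf \<pi>"
proof (cases "\<pi> \<in> S")
  case True
  note SS = J_skeletonD(1)[OF Mf S] and fr = stable_reps_framed[OF Mf]
  note c = minor_carrier[OF SS i, of Mf]
  note inv = mat_inv_mult[OF c J_skeletonD(2)[OF Mf S i]]
  have "\<pi> \<in> set (ord S i)" using True \<pi> skeletaD(5)[OF SS i] by (simp add: paths_at_def)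
  from theI'[OF distinct_Ex1[OF skeletaD(4)[OF SS i] this]]
  obtain r where r: "r = (THE r. r < length (ord S i) \<and> ord S i ! r = \<pi>)" "r < \<alpha> i" "ord S i ! r = \<pi>"
    using skeletaD(6)[OF SS i] by auto
  have "nf_row \<alpha> ord S (pi_skeleton Q \<alpha> \<zeta> ord S Mf) i \<pi> = row (minor S Mf i * mat_inv (minor S Mf i)) r"
    using True by (simp add: nf_row_def E_row_def inv(2) flip: r(1))
  also have "\<dots> = transpose_mat (mat_inv (minor S Mf i)) *\<^sub>v row (minor S Mf i) r"
    by (rule row_mult_mat[OF c inv(1) r(2)])
  also have "row (minor S Mf i) r = path_row Mf \<pi>" using row_minor[OF fr SS i r(2)] r(3) by simp
  finally show ?thesis .
next
  case False
  note SS = J_skeletonD(1)[OF Mf S]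
  note c = minor_carrier[OF SS i, of Mf]
  note inv = mat_inv_mult[OF c J_skeletonD(2)[OF Mf S i]]
  have "nf_row \<alpha> ord S (pi_skeleton Q \<alpha> \<zeta> ord S Mf) i \<pi> =
      transpose_mat (mat_inv (minor S Mf i)) *\<^sub>v Phi_hat Q \<alpha> \<zeta> Mf i \<pi>"
    using False i \<pi> by (simp add: nf_row_def pi_skeleton_def Let_def)
  also have "\<dots> = transpose_mat (mat_inv (minor S Mf i)) *\<^sub>v path_row Mf \<pi>"
    using \<Gamma>
  proof
    assume "\<pi> \<in> Gamma_tilde TYPE('k) Q \<alpha> \<zeta>"
    then show ?thesis using Phi_hat_eq[OF i _ \<pi>(1)] by simp
  next
    \<comment> \<open>Here \<open>Phi_hat\<close> may be unspecified at \<pi>, but the inverse is a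
      0 x 0 matrix, so the product is the empty vector in any case.\<close>
    assume "\<alpha> i = 0"
    then show ?thesis using inv(1) by (intro eq_vecI) auto
  qed
  finally show ?thesis .
qed

text \<open>The normal form is the representative of the orbit for which \<open>B(\<SS>\<^sub>i)\<close> is the identity.\<close>

lemma normal_form_eq:
  assumes Mf: "(Mf :: ('v, 'a, 'k) framed) \<in> stable_reps Q \<alpha> \<zeta>" and S: "S \<in> J_skeleta Q \<alpha> \<zeta> Mf"
  shows "normal_form Q \<alpha> \<zeta> ord S Mf = GL_act Q (\<lambda>i\<in>verts Q. minor S Mf i) Mf"
proof (rule prod_eqI)
  note SS = J_skeletonD(1)[OF Mf S] and fr = stable_reps_framed[OF Mf]
  note c = minor_carrier[OF SS, of _ Mf]
  have inv: "mat_inv (minor S Mf i) \<in> carrier_mat (\<alpha> i) (\<alpha> i)" if "i \<in> verts Q" for i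
    using mat_inv_mult(1)[OF c J_skeletonD(2)[OF Mf S]] that by blast
  let ?C = "pi_skeleton Q \<alpha> \<zeta> ord S Mf"
  show "fst (normal_form Q \<alpha> \<zeta> ord S Mf) = fst (GL_act Q (\<lambda>i\<in>verts Q. minor S Mf i) Mf)"
    unfolding normal_form_def nf_pair_def GL_act_def case_prod_unfold fst_conv
  proof (rule restrict_ext)
    fix a assume a: "a \<in> arcs Q"
    define t u where "t = tail Q a" and "u = head Q a"
    have v: "t \<in> verts Q" "u \<in> verts Q" using a by (auto simp: t_def u_def)
    note M = framed_carrier(1)[OF fr a, folded t_def u_def]
    have len: "length (ord S u) = \<alpha> u" using skeletaD(6)[OF SS v(2)] .
    have row: "nf_row \<alpha> ord S ?C t (Vertex t, Arrow a # snd (ord S u ! r)) =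
        row (minor S Mf u * fst Mf a * mat_inv (minor S Mf t)) r" if r: "r < \<alpha> u" for r
    proof -
      define p where "p = snd (ord S u ! r)"
      have at: "ord S u ! r \<in> paths_at S u" using skeletaD(5)[OF SS v(2)] len r nth_mem by metis
      then have up1: "ord S u ! r = (Vertex u, p)" by (simp add: paths_at_def p_def prod_eq_iff)
      with at have "(Vertex u, p) \<in> S" by (simp add: paths_at_def)
      note up = up1 this subsetD[OF skeletaD(1)[OF SS] this, THEN DiffD1]
      have in_inf: "(Vertex t, Arrow a # p) \<in> inf_paths" using up(3) a by (simp add: t_def u_def)
      have "(Vertex u, p) \<in> Gamma TYPE('k) Q \<alpha> \<zeta>" using up(2) skeletaD(3)[OF SS] by blast
      then have \<Gamma>: "(Vertex t, Arrow a # p) \<in> Gamma_tilde TYPE('k) Q \<alpha> \<zeta>"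
        using a unfolding Gamma_tilde_def t_def u_def by blast
      have hat: "(Vertex t, Arrow a # p) \<in> S \<or> (Vertex t, Arrow a # p) \<in> hat_skeleton Q \<zeta> S t"
        using a up(2) by (auto simp: hat_skeleton_def t_def u_def)
      \<comment> \<open>Row r of B(\<SS>_u) M_a belongs to the path \<tau>a, where \<tau> is the
        r-th path of \<SS>_u; pairing with unit vectors turns the product rule into an equality of
        entries.\<close>
      have "path_row Mf (Vertex t, Arrow a # p) = row (minor S Mf u * fst Mf a) r"
      proof (rule eq_vecI)
        fix j assume "j < dim_vec (row (minor S Mf u * fst Mf a) r)"
        then have j: "j < \<alpha> t" using M by simp
        have "path_row Mf (Vertex t, Arrow a # p) \<bullet> unit_vec (\<alpha> t) j =
            path_row Mf (Vertex u, p) \<bullet> (fst Mf a *\<^sub>v unit_vec (\<alpha> t) j)"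
          using path_row_arrow[OF fr a, of p "unit_vec (\<alpha> t) j"] up(3) by (simp add: t_def u_def)
        moreover have "fst Mf a *\<^sub>v unit_vec (\<alpha> t) j = col (fst Mf a) j"
          using M j by (intro eq_vecI) auto
        ultimately show "path_row Mf (Vertex t, Arrow a # p) $ j = row (minor S Mf u * fst Mf a) r $ j"
          using path_row_carrier[OF fr in_inf] row_minor[OF fr SS v(2) r] up(1) j r M c[OF v(2)] by simp
      qed (use path_row_carrier[OF fr in_inf] M in auto)
      then have "nf_row \<alpha> ord S ?C t (Vertex t, Arrow a # p) =
          transpose_mat (mat_inv (minor S Mf t)) *\<^sub>v row (minor S Mf u * fst Mf a) r"
        using nf_row_eq[OF Mf S v(1) _ in_inf hat] \<Gamma> by simp
      also have "\<dots> = row (minor S Mf u * fst Mf a * mat_inv (minor S Mf t)) r"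
        using c[OF v(2)] M inv[OF v(1)] r by (intro row_mult_mat[symmetric]) auto
      finally show ?thesis by (simp add: p_def)
    qed
    have "mat_of_rows (\<alpha> t) (map (\<lambda>\<tau>. nf_row \<alpha> ord S ?C t (Vertex t, Arrow a # snd \<tau>)) (ord S u)) =
        minor S Mf u * fst Mf a * mat_inv (minor S Mf t)"
    proof (rule eq_rowI)
      fix r assume "r < dim_row (minor S Mf u * fst Mf a * mat_inv (minor S Mf t))"
      then have r: "r < \<alpha> u" using c[OF v(2)] by simp
      have "row (minor S Mf u * fst Mf a * mat_inv (minor S Mf t)) r \<in> carrier_vec (\<alpha> t)"
        using inv[OF v(1)] by (intro carrier_vecI) simp
      then show "row (mat_of_rows (\<alpha> t) (map (\<lambda>\<tau>. nf_row \<alpha> ord S ?C t (Vertex t, Arrow a # snd \<tau>)) (ord S u))) r =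
          row (minor S Mf u * fst Mf a * mat_inv (minor S Mf t)) r"
        using len r row[OF r] by (subst mat_of_rows_row) auto
    qed (use len c[OF v(2)] inv[OF v(1)] in auto)
    then show "mat_of_rows (\<alpha> (tail Q a)) (map (\<lambda>\<tau>. nf_row \<alpha> ord S ?C (tail Q a)
          (Vertex (tail Q a), Arrow a # snd \<tau>)) (ord S (head Q a))) =
        restrict (minor S Mf) (verts Q) (head Q a) * fst Mf a *
          mat_inv (restrict (minor S Mf) (verts Q) (tail Q a))"
      using v by (simp add: t_def u_def)
  qed
  show "snd (normal_form Q \<alpha> \<zeta> ord S Mf) = snd (GL_act Q (\<lambda>i\<in>verts Q. minor S Mf i) Mf)"
    unfolding normal_form_def nf_pair_def GL_act_def case_prod_unfold snd_conv
  proof (rule restrict_ext)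
    fix i assume i: "i \<in> verts Q"
    note F = framed_carrier(2)[OF fr i]
    have row: "nf_row \<alpha> ord S ?C i (Vertex i, [Frame i q]) = row (snd Mf i * mat_inv (minor S Mf i)) q"
      if q: "q < \<zeta> i" for q
    proof -
      \<comment> \<open>Unlike the paths \<tau>a above, a frame arrow outside \<SS> is not in
        \<Gamma>~ by construction; here \<open>frame_in_Gamma\<close> is indispensable.\<close>
      have "(Vertex i, [Frame i q]) \<in> Gamma_tilde TYPE('k) Q \<alpha> \<zeta> \<or> \<alpha> i = 0"
        using frame_in_Gamma[OF Mf i q] by (auto simp: Gamma_tilde_def)
      then have "nf_row \<alpha> ord S ?C i (Vertex i, [Frame i q]) =
          transpose_mat (mat_inv (minor S Mf i)) *\<^sub>v path_row Mf (Vertex i, [Frame i q])"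
        using i q by (intro nf_row_eq[OF Mf S i]) (auto simp: hat_skeleton_def)
      then show ?thesis
        using path_row_frame[OF fr i q] row_mult_mat[OF F inv[OF i] q] by simp
    qed
    have "mat_of_rows (\<alpha> i) (map (\<lambda>q. nf_row \<alpha> ord S ?C i (Vertex i, [Frame i q])) [0..<\<zeta> i]) =
        snd Mf i * mat_inv (minor S Mf i)"
    proof (rule eq_rowI)
      fix q assume "q < dim_row (snd Mf i * mat_inv (minor S Mf i))"
      then have q: "q < \<zeta> i" using F by simp
      have "row (snd Mf i * mat_inv (minor S Mf i)) q \<in> carrier_vec (\<alpha> i)"
        using inv[OF i] by (intro carrier_vecI) simp
      then show "row (mat_of_rows (\<alpha> i) (map (\<lambda>q. nf_row \<alpha> ord S ?C i (Vertex i, [Frame i q])) [0..<\<zeta> i])) q =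
          row (snd Mf i * mat_inv (minor S Mf i)) q"
        using q row[OF q] by (subst mat_of_rows_row) auto
    qed (use F inv[OF i] in auto)
    then show "mat_of_rows (\<alpha> i) (map (\<lambda>q. nf_row \<alpha> ord S ?C i (Vertex i, [Frame i q])) [0..<\<zeta> i]) =
        snd Mf i * mat_inv (restrict (minor S Mf) (verts Q) i)"
      using i by simp
  qed
qed

section \<open>Normal forms as a complete invariant\<close>

lemma minor_GL:
  assumes "(Mf :: ('v, 'a, 'k) framed) \<in> stable_reps Q \<alpha> \<zeta>" "S \<in> J_skeleta Q \<alpha> \<zeta> Mf"
  shows "(\<lambda>i\<in>verts Q. minor S Mf i) \<in> GL Q \<alpha>"
  using J_skeletonD[OF assms] minor_carrier by (intro GL_I) auto

text \<open>If Mf' = g Mf, the normalizing element for Mf' composed with g is the normalizing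
  element for Mf, by \<open>minor_GL_act\<close>. Both normal forms are therefore the same point of
  the orbit.\<close>

lemma normal_form_isomorphic:
  assumes Mf: "(Mf :: ('v, 'a, 'k) framed) \<in> stable_reps Q \<alpha> \<zeta>" and S: "S \<in> J_skeleta Q \<alpha> \<zeta> Mf"
    and iso: "isomorphic Q \<alpha> Mf Mf'"
  shows "normal_form Q \<alpha> \<zeta> ord S Mf' = normal_form Q \<alpha> \<zeta> ord S Mf"
proof -
  obtain g where g: "g \<in> GL Q \<alpha>" "Mf' = GL_act Q g Mf" using iso by (auto simp: isomorphic_def)
  have Mf': "Mf' \<in> stable_reps Q \<alpha> \<zeta>" and S': "S \<in> J_skeleta Q \<alpha> \<zeta> Mf'"
    using GL_act_stable[OF g(1) Mf] J_skeleta_GL_act[OF g(1) Mf] S g(2) by auto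
  have "normal_form Q \<alpha> \<zeta> ord S Mf' =
      GL_act Q (\<lambda>i\<in>verts Q. (\<lambda>i\<in>verts Q. minor S Mf' i) i * g i) Mf"
    unfolding normal_form_eq[OF Mf' S'] using GL_act_comp[OF minor_GL[OF Mf' S'] g(1) stable_reps_framed[OF Mf]] g(2)
    by simp
  also have "\<dots> = GL_act Q (\<lambda>i\<in>verts Q. minor S Mf i) Mf"
    using minor_GL_act[OF g(1) stable_reps_framed[OF Mf] J_skeletonD(1)[OF Mf S]] g(2)
    by (intro GL_act_cong) simp
  finally show ?thesis unfolding normal_form_eq[OF Mf S] .
qed

lemma normal_form_stable:
  assumes "(Mf :: ('v, 'a, 'k) framed) \<in> stable_reps Q \<alpha> \<zeta>" "S \<in> J_skeleta Q \<alpha> \<zeta> Mf"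
  shows "normal_form Q \<alpha> \<zeta> ord S Mf \<in> stable_reps Q \<alpha> \<zeta>"
    "isomorphic Q \<alpha> Mf (normal_form Q \<alpha> \<zeta> ord S Mf)"
  unfolding normal_form_eq[OF assms] isomorphic_def
  using GL_act_stable[OF minor_GL[OF assms] assms(1)] minor_GL[OF assms] by auto

text \<open>The contrapositive justifies the negative answer of the procedure. Isomorphic pairs have
  equal sets of skeleta, and these sets are nonempty since the empty set of paths extends to a
  skeleton.\<close>

lemma J_skeleta_isomorphic:
  assumes Mf: "(Mf :: ('v, 'a, 'k) framed) \<in> stable_reps Q \<alpha> \<zeta>" and iso: "isomorphic Q \<alpha> Mf Mf'"
  shows "J_skeleta Q \<alpha> \<zeta> Mf \<inter> J_skeleta Q \<alpha> \<zeta> Mf' \<noteq> {}"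
proof -
  obtain S where "S \<in> J_skeleta Q \<alpha> \<zeta> Mf"
    using extend_to_J_skeleton[OF Mf indep_paths_empty] by blast
  then show ?thesis using iso J_skeleta_GL_act[OF _ Mf] by (auto simp: isomorphic_def)
qed

text \<open>In the backward direction each normal form lies in the orbit of its pair, so equal
  normal forms put both pairs into one orbit.\<close>

lemma isomorphic_iff_normal_form:
  assumes Mf: "(Mf :: ('v, 'a, 'k) framed) \<in> stable_reps Q \<alpha> \<zeta>" "S \<in> J_skeleta Q \<alpha> \<zeta> Mf"
    and Mf': "Mf' \<in> stable_reps Q \<alpha> \<zeta>" "S \<in> J_skeleta Q \<alpha> \<zeta> Mf'"
  shows "isomorphic Q \<alpha> Mf Mf' \<longleftrightarrow> normal_form Q \<alpha> \<zeta> ord S Mf = normal_form Q \<alpha> \<zeta> ord S Mf'"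
proof
  assume "isomorphic Q \<alpha> Mf Mf'"
  then show "normal_form Q \<alpha> \<zeta> ord S Mf = normal_form Q \<alpha> \<zeta> ord S Mf'"
    using normal_form_isomorphic[OF Mf] by simp
next
  assume "normal_form Q \<alpha> \<zeta> ord S Mf = normal_form Q \<alpha> \<zeta> ord S Mf'"
  then show "isomorphic Q \<alpha> Mf Mf'"
    unfolding normal_form_eq[OF Mf] normal_form_eq[OF Mf']
    by (rule isomorphic_if_common_orbit[OF minor_GL[OF Mf] minor_GL[OF Mf'] stable_reps_framed[OF Mf(1)] stable_reps_framed[OF Mf'(1)]])
qed

end

end

theorem corollary3p4:
  fixes Q :: "('v, 'a) pre_digraph"
    and \<alpha> \<zeta> :: "'v \<Rightarrow> nat"
    and ord :: "('v, 'a) path_order"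
  assumes "fin_digraph Q"
    and "is_path_order TYPE('k :: field) Q \<alpha> \<zeta> ord"
  shows
    "(\<forall>Mf \<in> (stable_reps Q \<alpha> \<zeta> :: ('v, 'a, 'k) framed set).
        finite (J_skeleta Q \<alpha> \<zeta> Mf) \<and>
        (\<forall>S \<in> J_skeleta Q \<alpha> \<zeta> Mf.
           normal_form Q \<alpha> \<zeta> ord S Mf \<in> stable_reps Q \<alpha> \<zeta> \<and>
           isomorphic Q \<alpha> Mf (normal_form Q \<alpha> \<zeta> ord S Mf) \<and>
           (\<forall>Mf' \<in> stable_reps Q \<alpha> \<zeta>. isomorphic Q \<alpha> Mf Mf' \<longrightarrow>
              normal_form Q \<alpha> \<zeta> ord S Mf' = normal_form Q \<alpha> \<zeta> ord S Mf))) \<and>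
     (\<forall>Mf \<in> (stable_reps Q \<alpha> \<zeta> :: ('v, 'a, 'k) framed set). \<forall>Mf' \<in> stable_reps Q \<alpha> \<zeta>.
        (\<forall>i\<in>verts Q. finite (paths_at (Gamma_tilde TYPE('k) Q \<alpha> \<zeta>) i)) \<and>
        skeleta_by_minors Q \<alpha> \<zeta> ord (Phi_hat Q \<alpha> \<zeta> Mf) = J_skeleta Q \<alpha> \<zeta> Mf \<and>
        skeleta_by_minors Q \<alpha> \<zeta> ord (Phi_hat Q \<alpha> \<zeta> Mf') = J_skeleta Q \<alpha> \<zeta> Mf' \<and>
        (J_skeleta Q \<alpha> \<zeta> Mf \<inter> J_skeleta Q \<alpha> \<zeta> Mf' = {} \<longrightarrow> \<not> isomorphic Q \<alpha> Mf Mf') \<and>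
        (\<forall>S \<in> J_skeleta Q \<alpha> \<zeta> Mf \<inter> J_skeleta Q \<alpha> \<zeta> Mf'.
           isomorphic Q \<alpha> Mf Mf' \<longleftrightarrow>
           nf_pair Q \<alpha> \<zeta> ord S (pi_skeleton Q \<alpha> \<zeta> ord S Mf) =
           nf_pair Q \<alpha> \<zeta> ord S (pi_skeleton Q \<alpha> \<zeta> ord S Mf')))"
proof -
  interpret framed_quiver Q \<alpha> \<zeta> by (intro framed_quiver.intro assms(1))
  note ord = assms(2)
  \<comment> \<open>The matrices in B have finitely many rows, so computing them is a finite
    task.\<close>
  have fin: "finite (paths_at (Gamma_tilde TYPE('k) Q \<alpha> \<zeta>) i)" for i
    using finite_Gamma_tilde by (rule finite_subset[rotated]) (auto simp: paths_at_def)
  show ?thesis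
    unfolding normal_form_def[symmetric]
  proof (intro conjI ballI impI)
    fix Mf :: "('v, 'a, 'k) framed" and S
    assume Mf: "Mf \<in> stable_reps Q \<alpha> \<zeta>"
    then show "finite (J_skeleta Q \<alpha> \<zeta> Mf)" by (rule finite_J_skeleta)
    assume S: "S \<in> J_skeleta Q \<alpha> \<zeta> Mf"
    show "normal_form Q \<alpha> \<zeta> ord S Mf \<in> stable_reps Q \<alpha> \<zeta>"
      "isomorphic Q \<alpha> Mf (normal_form Q \<alpha> \<zeta> ord S Mf)"
      using normal_form_stable[OF ord Mf S] by auto
    show "normal_form Q \<alpha> \<zeta> ord S Mf' = normal_form Q \<alpha> \<zeta> ord S Mf"
      if "isomorphic Q \<alpha> Mf Mf'" for Mf'
      using normal_form_isomorphic[OF ord Mf S that] .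
  next
    fix Mf Mf' :: "('v, 'a, 'k) framed"
    assume Mf: "Mf \<in> stable_reps Q \<alpha> \<zeta>" and Mf': "Mf' \<in> stable_reps Q \<alpha> \<zeta>"
    show "finite (paths_at (Gamma_tilde TYPE('k) Q \<alpha> \<zeta>) i)" for i by (rule fin)
    show "skeleta_by_minors Q \<alpha> \<zeta> ord (Phi_hat Q \<alpha> \<zeta> Mf) = J_skeleta Q \<alpha> \<zeta> Mf"
      "skeleta_by_minors Q \<alpha> \<zeta> ord (Phi_hat Q \<alpha> \<zeta> Mf') = J_skeleta Q \<alpha> \<zeta> Mf'"
      using skeleta_by_minors_eq[OF ord] Mf Mf' by auto
    show "\<not> isomorphic Q \<alpha> Mf Mf'" if "J_skeleta Q \<alpha> \<zeta> Mf \<inter> J_skeleta Q \<alpha> \<zeta> Mf' = {}"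
      using J_skeleta_isomorphic[OF ord Mf] that by blast
    show "isomorphic Q \<alpha> Mf Mf' \<longleftrightarrow> normal_form Q \<alpha> \<zeta> ord S Mf = normal_form Q \<alpha> \<zeta> ord S Mf'"
      if "S \<in> J_skeleta Q \<alpha> \<zeta> Mf \<inter> J_skeleta Q \<alpha> \<zeta> Mf'" for S
      using that by (intro isomorphic_iff_normal_form[OF ord Mf _ Mf']) auto
  qed
qed

end
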